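(* Let $G$ be a finitely generated discrete group with word length $\ell$, let $H\le G$ be a subgroup, and let $X=G/H$. Assume that $(G,H)$ has pair rapid decay with constants $C_h>0$ and $s_1>0$. Let $\mu$ be a probability measure on $G$ with finite entropy and with finite $\beta$-moment with respect to $1+\ell$ for some $\beta\ge 2s_1$. Then $$\underline{h}(X,\mu)=\overline{h}(X,\mu)=c(G,H;\mu).$$ Hence the asymptotic Shannon entropy $h(X,\mu):=\lim_{n\to\infty}\frac1n H(\mu^{*n}*\delta_{eH})$ exists, and $$\lim_{\alpha\downarrow 1}\underline{h}_\alpha(X,\mu)=\lim_{\alpha\downarrow 1}\overline{h}_\alpha(X,\mu)=h(X,\mu).$$ If $\mu$ is finitely supported, then for every $\alpha\in(1,2]$ the limit $h_\alpha(X,\mu):=\lim_{n\to\infty}\frac1n H_\alpha(\mu^{*n}*\delta_{eH})$ exists and satisfies $$h_\alpha(X,\mu)=\frac{\alpha}{1-\alpha}\log r_\alpha(\mu).$$ In particular, $\lim_{\alpha\downarrow 1}h_\alpha(X,\mu)=h(X,\mu)$.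
   Context: $\ell$ is the word length on $G$ for a fixed finite symmetric generating set; $\mathbb{C}G$ is the group algebra (finitely supported functions on $G$, with convolution). Norms: for $f\in\mathbb{C}G$, $\|f\|_{(2,1)}=\|f\|_{(2,1),(G,H)}:=\bigl(\sum_{x\in G/H}(\sum_{g\in x}|f(g)|)^2\bigr)^{1/2}$ (sum over left cosets), and $\|f\|_h=\|f\|_{h,(G,H)}:=\sup\{\|f*\varphi\|_{(2,1)}:\varphi\in\mathbb{C}G,\ \|\varphi\|_{(2,1)}=1\}$. Pair rapid decay: $(G,H)$ has pair rapid decay (with constants $C_h,s_1>0$) if $\|f\|_h\le C_h\|f(1+\ell)^{s_1}\|_{(2,1)}$ for all $f\in\mathbb{C}G$. Finite entropy: $H(\mu)=-\sum_g\mu(g)\log\mu(g)<\infty$. Finite $\beta$-moment with respect to $1+\ell$: $\sum_g\mu(g)(1+\ell(g))^\beta<\infty$. Random walk on $X$: $\nu_n:=\mu^{*n}*\delta_{eH}$, i.e. $\nu_n(x)=\sum_{g\in x}\mu^{*n}(g)$ for $x\in X$. For a probability measure $\nu$ on $X$, the Shannon entropy is $H(\nu)=-\sum_x\nu(x)\log\nu(x)$ (with $0\log 0=0$), and for $\alpha>1$ the Rényi entropy is $H_\alpha(\nu)=\frac{1}{1-\alpha}\log\bigl(\sum_x\nu(x)^\alpha\bigr)$. Set $\underline h(X,\mu)=\liminf_n\frac1nH(\nu_n)$, $\overline h(X,\mu)=\limsup_n\frac1nH(\nu_n)$, $\underline h_\alpha(X,\mu)=\liminf_n\frac1nH_\alpha(\nu_n)$,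 $\overline h_\alpha(X,\mu)=\limsup_n\frac1nH_\alpha(\nu_n)$. Quasi-regular representation: for $1\le q\le\infty$, $(\lambda_{X,q}(g)\xi)(x)=\xi(g^{-1}x)$ on $\ell^q(X)$, and $\lambda_{X,q}(\mu)=\sum_g\mu(g)\lambda_{X,q}(g)$. Its spectral radius is $r_q(\mu)=\lim_n\|\lambda_{X,q}(\mu)^n\|_{B(\ell^q(X))}^{1/n}$. Finally $c(G,H;\mu):=\lim_{p\to\infty}\bigl(-p\log r_{p/(p-1)}(\mu)\bigr)$; for $\mu$ of finite entropy, $r_q(\mu)>0$ for all $q\in(1,2]$ and $p\mapsto -p\log r_{p/(p-1)}(\mu)$ is nondecreasing on $[2,\infty)$, so this limit exists in $[0,\infty]$. *)

theory Defs
  imports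
    "HOL-Algebra.Left_Coset"
    "HOL-Algebra.Generated_Groups"
    "HOL-Probability.Probability"
begin

definition symmetric_generating_set :: "('a, 'b) monoid_scheme \<Rightarrow> 'a set \<Rightarrow> bool" where
  "symmetric_generating_set G S \<longleftrightarrow>
     finite S \<and> S \<subseteq> carrier G \<and> (\<forall>s\<in>S. inv\<^bsub>G\<^esub> s \<in> S) \<and> generate G S = carrier G"

definition word_length :: "('a, 'b) monoid_scheme \<Rightarrow> 'a set \<Rightarrow> 'a \<Rightarrow> nat" where
  "word_length G S g =
     (LEAST n. \<exists>ws. set ws \<subseteq> S \<and> length ws = n \<and> foldr (\<lambda>a b. a \<otimes>\<^bsub>G\<^esub> b) ws \<one>\<^bsub>G\<^esub> = g)"

definition group_algebra :: "('a, 'b) monoid_scheme \<Rightarrow> ('a \<Rightarrow> complex) set" where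
  "group_algebra G = {f. finite {g. f g \<noteq> 0} \<and> {g. f g \<noteq> 0} \<subseteq> carrier G}"

definition convolve ::
  "('a, 'b) monoid_scheme \<Rightarrow> ('a \<Rightarrow> complex) \<Rightarrow> ('a \<Rightarrow> complex) \<Rightarrow> 'a \<Rightarrow> complex" where
  "convolve G f \<phi> x =
     (if x \<in> carrier G then \<Sum>\<^sub>\<infinity>y\<in>carrier G. f y * \<phi> (inv\<^bsub>G\<^esub> y \<otimes>\<^bsub>G\<^esub> x) else 0)"

definition norm21 :: "('a, 'b) monoid_scheme \<Rightarrow> 'a set \<Rightarrow> ('a \<Rightarrow> complex) \<Rightarrow> real" where
  "norm21 G H f = sqrt (\<Sum>\<^sub>\<infinity>x\<in>lcosets\<^bsub>G\<^esub> H. (\<Sum>\<^sub>\<infinity>g\<in>x. cmod (f g))\<^sup>2)"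

text \<open>For \<open>f\<close> in the group algebra the supremum is over a nonempty set bounded by the
  \<open>\<ell>\<^sup>1\<close>-norm of \<open>f\<close>, because left translations are isometries for \<open>norm21\<close>.\<close>

definition norm_h :: "('a, 'b) monoid_scheme \<Rightarrow> 'a set \<Rightarrow> ('a \<Rightarrow> complex) \<Rightarrow> real" where
  "norm_h G H f =
     Sup {norm21 G H (convolve G f \<phi>) | \<phi>. \<phi> \<in> group_algebra G \<and> norm21 G H \<phi> = 1}"

definition pair_rapid_decay ::
  "('a, 'b) monoid_scheme \<Rightarrow> 'a set \<Rightarrow> ('a \<Rightarrow> nat) \<Rightarrow> real \<Rightarrow> real \<Rightarrow> bool" where
  "pair_rapid_decay G H l C s \<longleftrightarrow> C > 0 \<and> s > 0 \<and>
     (\<forall>f\<in>group_algebra G.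
        norm_h G H f \<le> C * norm21 G H (\<lambda>g. f g * of_real ((1 + real (l g)) powr s)))"

text \<open>Probability measures on \<open>G\<close> are \<open>pmf\<close>s supported in the carrier; the convolution of two of
  them is the law of the product of independent samples.\<close>

definition convolve_pmf :: "('a, 'b) monoid_scheme \<Rightarrow> 'a pmf \<Rightarrow> 'a pmf \<Rightarrow> 'a pmf" where
  "convolve_pmf G \<mu> \<nu> = map_pmf (\<lambda>(g, h). g \<otimes>\<^bsub>G\<^esub> h) (pair_pmf \<mu> \<nu>)"

primrec conv_power :: "('a, 'b) monoid_scheme \<Rightarrow> 'a pmf \<Rightarrow> nat \<Rightarrow> 'a pmf" where
  "conv_power G \<mu> 0 = return_pmf \<one>\<^bsub>G\<^esub>"
| "conv_power G \<mu> (Suc n) = convolve_pmf G \<mu> (conv_power G \<mu> n)"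

text \<open>The law \<open>\<mu>\<^sup>*\<^sup>n * \<delta>\<^sub>e\<^sub>H\<close> of the walk on \<open>G/H\<close>: its mass at a left coset \<open>x\<close> is the
  \<open>\<mu>\<^sup>*\<^sup>n\<close>-mass of the set \<open>x\<close>.\<close>

definition coset_walk :: "('a, 'b) monoid_scheme \<Rightarrow> 'a set \<Rightarrow> 'a pmf \<Rightarrow> nat \<Rightarrow> 'a set pmf" where
  "coset_walk G H \<mu> n = map_pmf (\<lambda>g. g <#\<^bsub>G\<^esub> H) (conv_power G \<mu> n)"

text \<open>Entropies use natural logarithms; \<open>0 log 0 = 0\<close> holds by \<open>0 * ln 0 = 0\<close>. Shannon entropy takes
  values in \<open>[0, \<infinity>]\<close>; the Renyi sum lies in \<open>(0, 1]\<close> for \<open>\<alpha> > 1\<close>.\<close>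

definition shannon_entropy :: "'x pmf \<Rightarrow> ereal" where
  "shannon_entropy \<nu> = enn2ereal (\<Sum>\<^sub>\<infinity>x. ennreal (- (pmf \<nu> x * ln (pmf \<nu> x))))"

definition renyi_entropy :: "real \<Rightarrow> 'x pmf \<Rightarrow> real" where
  "renyi_entropy \<alpha> \<nu> = 1 / (1 - \<alpha>) * ln (\<Sum>\<^sub>\<infinity>x. pmf \<nu> x powr \<alpha>)"

definition shannon_seq :: "('a, 'b) monoid_scheme \<Rightarrow> 'a set \<Rightarrow> 'a pmf \<Rightarrow> nat \<Rightarrow> ereal" where
  "shannon_seq G H \<mu> n = ereal (1 / real n) * shannon_entropy (coset_walk G H \<mu> n)"

definition renyi_seq :: "('a, 'b) monoid_scheme \<Rightarrow> 'a set \<Rightarrow> 'a pmf \<Rightarrow> real \<Rightarrow> nat \<Rightarrow> real" where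
  "renyi_seq G H \<mu> \<alpha> n = 1 / real n * renyi_entropy \<alpha> (coset_walk G H \<mu> n)"

definition lower_shannon :: "('a, 'b) monoid_scheme \<Rightarrow> 'a set \<Rightarrow> 'a pmf \<Rightarrow> ereal" where
  "lower_shannon G H \<mu> = liminf (shannon_seq G H \<mu>)"

definition upper_shannon :: "('a, 'b) monoid_scheme \<Rightarrow> 'a set \<Rightarrow> 'a pmf \<Rightarrow> ereal" where
  "upper_shannon G H \<mu> = limsup (shannon_seq G H \<mu>)"

definition asymp_shannon :: "('a, 'b) monoid_scheme \<Rightarrow> 'a set \<Rightarrow> 'a pmf \<Rightarrow> ereal" where
  "asymp_shannon G H \<mu> = lim (shannon_seq G H \<mu>)"

definition lower_renyi :: "('a, 'b) monoid_scheme \<Rightarrow> 'a set \<Rightarrow> 'a pmf \<Rightarrow> real \<Rightarrow> ereal" where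
  "lower_renyi G H \<mu> \<alpha> = liminf (\<lambda>n. ereal (renyi_seq G H \<mu> \<alpha> n))"

definition upper_renyi :: "('a, 'b) monoid_scheme \<Rightarrow> 'a set \<Rightarrow> 'a pmf \<Rightarrow> real \<Rightarrow> ereal" where
  "upper_renyi G H \<mu> \<alpha> = limsup (\<lambda>n. ereal (renyi_seq G H \<mu> \<alpha> n))"

definition asymp_renyi :: "('a, 'b) monoid_scheme \<Rightarrow> 'a set \<Rightarrow> 'a pmf \<Rightarrow> real \<Rightarrow> real" where
  "asymp_renyi G H \<mu> \<alpha> = lim (renyi_seq G H \<mu> \<alpha>)"

text \<open>\<open>\<ell>\<^sup>q(X)\<close> for real \<open>q \<ge> 1\<close>. Its elements are represented by total functions on \<open>'x\<close>, whose values
  outside \<open>X\<close> are irrelevant.\<close>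

definition lq_space :: "real \<Rightarrow> 'x set \<Rightarrow> ('x \<Rightarrow> complex) set" where
  "lq_space q X = {\<xi>. (\<lambda>x. cmod (\<xi> x) powr q) summable_on X}"

definition lq_norm :: "real \<Rightarrow> 'x set \<Rightarrow> ('x \<Rightarrow> complex) \<Rightarrow> real" where
  "lq_norm q X \<xi> = (\<Sum>\<^sub>\<infinity>x\<in>X. cmod (\<xi> x) powr q) powr (1 / q)"

text \<open>Meaningful for bounded operators \<open>T\<close> from \<open>\<ell>\<^sup>q(X)\<close> to itself.\<close>

definition lq_opnorm :: "real \<Rightarrow> 'x set \<Rightarrow> (('x \<Rightarrow> complex) \<Rightarrow> 'x \<Rightarrow> complex) \<Rightarrow> real" where
  "lq_opnorm q X T = Sup {lq_norm q X (T \<xi>) | \<xi>. \<xi> \<in> lq_space q X \<and> lq_norm q X \<xi> \<le> 1}"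

definition quasi_regular ::
  "('a, 'b) monoid_scheme \<Rightarrow> 'a \<Rightarrow> ('a set \<Rightarrow> complex) \<Rightarrow> 'a set \<Rightarrow> complex" where
  "quasi_regular G g \<xi> x = \<xi> (inv\<^bsub>G\<^esub> g <#\<^bsub>G\<^esub> x)"

text \<open>The series \<open>\<Sum>\<^sub>g \<mu>(g) \<lambda>\<^sub>X(g)\<close> converges absolutely in operator norm, hence pointwise.\<close>

definition quasi_regular_op ::
  "('a, 'b) monoid_scheme \<Rightarrow> 'a pmf \<Rightarrow> ('a set \<Rightarrow> complex) \<Rightarrow> 'a set \<Rightarrow> complex" where
  "quasi_regular_op G \<mu> \<xi> x =
     (\<Sum>\<^sub>\<infinity>g\<in>carrier G. of_real (pmf \<mu> g) * quasi_regular G g \<xi> x)"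

definition quasi_regular_radius ::
  "('a, 'b) monoid_scheme \<Rightarrow> 'a set \<Rightarrow> 'a pmf \<Rightarrow> real \<Rightarrow> real" where
  "quasi_regular_radius G H \<mu> q =
     lim (\<lambda>n. lq_opnorm q (lcosets\<^bsub>G\<^esub> H) (quasi_regular_op G \<mu> ^^ n) powr (1 / real n))"

text \<open>The radius is positive for \<open>\<mu>\<close> of finite entropy and \<open>1 < q \<le> 2\<close>, so the convention
  \<open>ln 0 = 0\<close> plays no role; the limit exists in \<open>[0, \<infinity>]\<close> by monotonicity in \<open>p\<close>.\<close>

definition entropy_const :: "('a, 'b) monoid_scheme \<Rightarrow> 'a set \<Rightarrow> 'a pmf \<Rightarrow> ereal" where
  "entropy_const G H \<mu> =
     Lim at_top (\<lambda>p::real. ereal (- p * ln (quasi_regular_radius G H \<mu> (p / (p - 1)))))"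

end

(* With p = alpha / (alpha - 1) and r_alpha the spectral radius of mu on l^alpha(G/H), both entropies
   are squeezed between quantities governed by -p ln r_alpha.

   Lower bound: nu_n is the image of the point mass at eH under the n-th power T^n of the operator,
   so its l^alpha-norm is at most the operator norm of T^n; hence the Renyi entropy rate, and a
   fortiori the Shannon entropy rate, is at least -p ln r_alpha.

   Upper bound: for a probability m on G with image nu on G/H, pair rapid decay on l^2 interpolated
   with the trivial bound on l^1 gives, with e = alpha - 1,
     |lambda(m)|_alpha ^ alpha <= C^(2e) * E_m [(nu(gH) (1 + l(g))^(2s))^e].
   All functions involved are nonnegative, so two applications of Hoelder's inequality replace
   complex interpolation. The moment of order 2s makes the bracket integrable at e = 1, and
   differentiating at e = 0 with m the n-th convolution power of mu yields
     liminf -p ln r_alpha >= (H(nu_n) - 2s E_m [ln (1 + l)] - 2 ln C) / n  as alpha tends to 1.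
   The expected logarithm of the length is O(log n), so letting n tend to infinity closes the gap;
   for finite support the same inequality bounds |T^n|_alpha by a polynomial times |nu_n|_alpha. *)

theory Submission
  imports Defs "HOL-Real_Asymp.Real_Asymp"
begin

no_notation Multiset.subset_mset (infix \<open><#\<close> 50) \<comment> \<open>frees the syntax for left cosets\<close>

section \<open>Subadditive sequences and elementary inequalities\<close>

text \<open>The obstacle is an exchange of limits: the radius is a limit in n at fixed alpha, the
  Shannon rate a limit in n after alpha has reached 1. Submultiplicativity resolves it: the radius
  is the infimum over n of |T^n|^(1/n), so a bound for a single n already bounds it, alpha may tend
  to 1 while n stays fixed, and only an additive error, divided by n, has to vanish afterwards. The
  exponent alpha = 1 + e lies between 1 and 2 at t = 2e/(1 + e), since 1/alpha = (1 - t) + t/2. The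
  weight K(g) = nu(gH) (1 + l(g))^(2s) is the one for which the l^1 factor and, up to C^2, the l^2
  factor have the same bound E_m[K^e]: nu(gH) comes from Cauchy-Schwarz inside a coset, and squaring
  there doubles s. Rapid decay concerns finitely supported functions on G, while T acts on an
  infinite space. Estimates are therefore proved for finite sets \<open>B\<close> of group elements
  and \<open>X0\<close>, \<open>Y\<close> of cosets, where \<open>Y\<close> contains the translates
  of \<open>X0\<close>; the passage to infinite sums is made once, in
  \<open>lq_bound\<close>.\<close>

lemma subadditive_tendsto:
  fixes u :: "nat \<Rightarrow> real"
  assumes sub: "\<And>m n. u (m + n) \<le> u m + u n" and lb: "\<And>n. u n \<ge> - K * real n"
  obtains l where "(\<lambda>n. u n / real n) \<longlonglongrightarrow> l" "\<And>n. n \<ge> 1 \<Longrightarrow> l \<le> u n / real n"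
proof -
  \<comment> \<open>Fekete's argument: the limit is the infimum of the slopes, which the linear
    lower bound keeps finite. The index 0 is excluded, its quotient being 0 by convention.\<close>
  define l where "l = Inf ((\<lambda>n. u n / real n) ` {1..})"
  have bdd: "bdd_below ((\<lambda>n. u n / real n) ` {1..})"
    by (rule bdd_belowI[of _ "-K"]) (use lb in \<open>auto simp: field_simps\<close>)
  have le: "l \<le> u n / real n" if "n \<ge> 1" for n
    unfolding l_def using that by (intro cInf_lower bdd) auto
  have mult: "u (q * m) \<le> real q * u m" if "q \<ge> 1" for q m
    using that
  proof (induction q rule: nat_induct_at_least)
    case base show ?case by simp
  next
    case (Suc q)
    have "u (Suc q * m) \<le> u m + u (q * m)" using sub[of m "q * m"] by simp
    also have "\<dots> \<le> u m + real q * u m" using Suc by simp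
    finally show ?case by (simp add: algebra_simps)
  qed
  have "(\<lambda>n. u n / real n) \<longlonglongrightarrow> l"
  proof (rule LIMSEQ_I)
    fix r :: real assume r: "r > 0"
    have "l < l + r / 2" using r by simp
    then obtain m where m: "m \<ge> 1" "u m / real m < l + r / 2"
      unfolding l_def using bdd by (subst (asm) cInf_less_iff) auto
    define D where "D = Max ((\<lambda>j. \<bar>u j\<bar>) ` {..<2*m})"
    have D: "\<bar>u j\<bar> \<le> D" if "j < 2 * m" for j unfolding D_def using that by (intro Max_ge) auto
    have D0: "D \<ge> 0" using D[of 0] m by auto
    \<comment> \<open>After division of n by \<open>m\<close>, the remainder costs at most
      \<open>D\<close> through \<open>u j\<close> and at most m (|l| + r) through replacing q m by
      n; \<open>N\<close> makes the two together smaller than r n / 4.\<close>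
    define N where "N = nat \<lceil>4 * (D + real m * (\<bar>l\<bar> + r)) / r\<rceil> + 2 * m + 1"
    show "\<exists>no. \<forall>n\<ge>no. norm (u n / real n - l) < r"
    proof (intro exI allI impI)
      fix n assume n: "n \<ge> N"
      have n1: "n \<ge> 1" "n \<ge> 2 * m" using n m by (auto simp: N_def)
      have big: "4 * (D + real m * (\<bar>l\<bar> + r)) / r < real n" using n unfolding N_def by linarith
      have big: "D + real m * (\<bar>l\<bar> + r) < r / 4 * real n" using big r by (simp add: field_simps)
      define q j where "q = n div m" and "j = n mod m"
      have nq: "n = q * m + j" by (simp add: q_def j_def)
      have jm: "j < m" using m by (simp add: j_def)
      have q1: "q \<ge> 1" using n1 m by (simp add: q_def Suc_le_eq div_greater_zero_iff)
      have "u n \<le> u (q * m) + u j" using sub nq by metis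
      also have "\<dots> \<le> real q * u m + D" using mult[OF q1, of m] D[of j] jm by linarith
      also have "real q * u m \<le> real q * (real m * (l + r / 2))"
        using m by (intro mult_left_mono) (auto simp: field_simps)
      also have "real q * (real m * (l + r / 2)) = (real n - real j) * (l + r / 2)"
        using nq by simp
      also have "\<dots> \<le> real n * (l + r / 2) + real m * (\<bar>l\<bar> + r)"
      proof -
        have "- real j * (l + r / 2) \<le> real j * (\<bar>l\<bar> + r)"
        proof -
          have "- (l + r / 2) \<le> \<bar>l\<bar> + r" using r by linarith
          then show ?thesis using mult_left_mono[of "- (l + r / 2)" "\<bar>l\<bar> + r" "real j"] by (simp add: algebra_simps)
        qed
        also have "\<dots> \<le> real m * (\<bar>l\<bar> + r)" using jm r by (intro mult_right_mono) auto
        finally show ?thesis by (simp add: algebra_simps)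
      qed
      finally have "u n \<le> real n * (l + r / 2) + (D + real m * (\<bar>l\<bar> + r))" by simp
      also have "\<dots> < real n * (l + r / 2) + r / 4 * real n" using big by simp
      finally have "u n / real n < l + 3 / 4 * r" using n1 by (simp add: field_simps)
      then show "norm (u n / real n - l) < r" using le[OF n1(1)] r by auto
    qed
  qed
  then show ?thesis using le that by blast
qed

text \<open>Hoelder for the exponents 1/(1 - t) and 1/t: normalise both sums to 1 and apply Young's
  inequality termwise. As \<open>0 powr t = 0\<close> even for t = 0, vanishing terms and sums
  contribute nothing, and the endpoints are included.\<close>

lemma Holder_sum:
  fixes u v :: "'i \<Rightarrow> real"
  assumes t: "0 \<le> t" "t \<le> 1" and u: "\<And>i. i \<in> I \<Longrightarrow> 0 \<le> u i" and v: "\<And>i. i \<in> I \<Longrightarrow> 0 \<le> v i"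
  shows "(\<Sum>i\<in>I. u i powr (1 - t) * v i powr t) \<le> (\<Sum>i\<in>I. u i) powr (1 - t) * (\<Sum>i\<in>I. v i) powr t"
proof (cases "finite I \<and> (\<Sum>i\<in>I. u i) \<noteq> 0 \<and> (\<Sum>i\<in>I. v i) \<noteq> 0")
  case False
  then consider "infinite I" | "finite I" "(\<Sum>i\<in>I. u i) = 0" | "finite I" "(\<Sum>i\<in>I. v i) = 0" by blast
  then show ?thesis
  proof cases
    case 2
    then have "u i = 0" if "i \<in> I" for i using sum_nonneg_eq_0_iff[of I u] u that by auto
    then show ?thesis by simp
  next
    case 3
    then have "v i = 0" if "i \<in> I" for i using sum_nonneg_eq_0_iff[of I v] v that by auto
    then show ?thesis by simp
  qed simp
next
  case True
  define U V where "U = (\<Sum>i\<in>I. u i)" and "V = (\<Sum>i\<in>I. v i)"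
  have pos: "U > 0" "V > 0" using True sum_nonneg[of I u] sum_nonneg[of I v] u v
    by (auto simp: U_def V_def less_le)
  have "u i powr (1 - t) * v i powr t \<le> (U powr (1 - t) * V powr t) * ((1 - t) * (u i / U) + t * (v i / V))"
    if i: "i \<in> I" for i
  proof (cases "u i = 0 \<or> v i = 0")
    case True
    then show ?thesis using pos t u[OF i] v[OF i] by (auto intro!: mult_nonneg_nonneg add_nonneg_nonneg)
  next
    case False
    then have p: "u i > 0" "v i > 0" using u[OF i] v[OF i] by auto
    have "(u i / U) powr (1 - t) * (v i / V) powr t \<le> (1 - t) * (u i / U) + t * (v i / V)"
      using Youngs_inequality_0[of "1 - t" t "u i / U" "v i / V"] t p pos by auto
    then have "(U powr (1 - t) * V powr t) * ((u i / U) powr (1 - t) * (v i / V) powr t)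
      \<le> (U powr (1 - t) * V powr t) * ((1 - t) * (u i / U) + t * (v i / V))"
      using pos by (intro mult_left_mono) auto
    moreover have "(U powr (1 - t) * V powr t) * ((u i / U) powr (1 - t) * (v i / V) powr t)
      = u i powr (1 - t) * v i powr t" using p pos by (simp add: powr_divide)
    ultimately show ?thesis by simp
  qed
  then have "(\<Sum>i\<in>I. u i powr (1 - t) * v i powr t)
     \<le> (\<Sum>i\<in>I. (U powr (1 - t) * V powr t) * ((1 - t) * (u i / U) + t * (v i / V)))"
    by (rule sum_mono)
  also have "\<dots> = (U powr (1 - t) * V powr t) * ((1 - t) * (U / U) + t * (V / V))"
    unfolding sum_distrib_left[symmetric] sum.distrib sum_divide_distrib[symmetric] U_def V_def ..
  also have "\<dots> = U powr (1 - t) * V powr t" using pos by simp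
  finally show ?thesis unfolding U_def V_def .
qed

text \<open>Split off one factor x + y and use that z powr (c - 1) does not increase with z. For 0 <
  c <= 1 this makes (1 + l)^c a subadditive weight.\<close>

lemma powr_add_subadditive:
  fixes x y :: real
  assumes "x > 0" "y > 0" "c \<le> 1"
  shows "(x + y) powr c \<le> x powr c + y powr c"
proof -
  have "(x + y) powr c = x * (x + y) powr (c - 1) + y * (x + y) powr (c - 1)"
    using assms by (simp add: powr_diff divide_simps) (simp add: algebra_simps)
  also have "\<dots> \<le> x * x powr (c - 1) + y * y powr (c - 1)"
    using assms by (intro add_mono mult_left_mono powr_mono2') auto
  also have "\<dots> = x powr c + y powr c" using assms by (simp add: powr_diff)
  finally show ?thesis .
qed

section \<open>Rapid decay on finitely supported functions\<close>

locale coset_space = group G for G (structure) +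
  fixes H
  assumes subgroup_H: "subgroup H G"
begin

abbreviation X where "X \<equiv> lcosets H"

lemma H_carrier: "H \<subseteq> carrier G" using subgroup_H by (rule subgroup.subset)

lemma coset_in_X: "g \<in> carrier G \<Longrightarrow> g <# H \<in> X" by (auto simp: LCOSETS_def)

lemma X_carrier: "x \<in> X \<Longrightarrow> x \<subseteq> carrier G"
  using subgroup.lcosets_carrier[OF subgroup_H] is_group by blast

lemma act_X: "g \<in> carrier G \<Longrightarrow> x \<in> X \<Longrightarrow> g <# x \<in> X"
  using H_carrier by (auto simp: LCOSETS_def lcos_m_assoc)

lemma act_act: "g \<in> carrier G \<Longrightarrow> h \<in> carrier G \<Longrightarrow> x \<in> X \<Longrightarrow> g <# (h <# x) = (g \<otimes> h) <# x"
  using X_carrier by (simp add: lcos_m_assoc)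

lemma act_one: "x \<in> X \<Longrightarrow> \<one> <# x = x"
  using X_carrier by (simp add: lcos_mult_one)

lemma act_inv1: "g \<in> carrier G \<Longrightarrow> x \<in> X \<Longrightarrow> inv g <# (g <# x) = x"
  by (simp add: act_act act_one)

lemma act_inv2: "g \<in> carrier G \<Longrightarrow> x \<in> X \<Longrightarrow> g <# (inv g <# x) = x"
  by (simp add: act_act act_one)

lemma inj_act: "g \<in> carrier G \<Longrightarrow> inj_on (\<lambda>x. g <# x) X"
  by (metis act_inv1 inj_onI)

lemma mem_coset_iff:
  assumes "x \<in> X" "g \<in> carrier G" shows "g \<in> x \<longleftrightarrow> g <# H = x"
proof -
  obtain a where a: "a \<in> carrier G" "x = a <# H" using assms by (auto simp: LCOSETS_def)
  show ?thesis using l_repr_independence[of g a H] a assms lcos_self[of g H] subgroup_H by auto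
qed

lemma coset_nonempty: "x \<in> X \<Longrightarrow> \<exists>g. g \<in> x"
  using lcos_self subgroup_H by (auto simp: LCOSETS_def)

lemma act_mult_bij:
  assumes "y \<in> carrier G" "x \<in> X"
  shows "bij_betw (\<lambda>z. y \<otimes> z) x (y <# x)"
proof -
  have "inj_on (\<lambda>z. y \<otimes> z) x" by (rule inj_on_subset[OF inj_on_cmult[OF assms(1)] X_carrier[OF assms(2)]])
  then show ?thesis by (auto simp: bij_betw_def l_coset_def)
qed

lemma has_sum_coset_finite:
  fixes u :: "'a \<Rightarrow> 'c :: {topological_comm_monoid_add, t2_space}"
  assumes "finite U" "U \<subseteq> carrier G" "\<And>g. g \<in> carrier G \<Longrightarrow> g \<notin> U \<Longrightarrow> u g = 0" "x \<in> X"
  shows "(u has_sum (\<Sum>g | g \<in> U \<and> g <# H = x. u g)) x"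
proof -
  have "(u has_sum (\<Sum>g | g \<in> U \<and> g <# H = x. u g)) {g \<in> U. g <# H = x}"
    using assms(1) by simp
  then show ?thesis
    using assms(2,3,4) X_carrier[OF assms(4)] mem_coset_iff[OF assms(4)]
    by (subst has_sum_cong_neutral[where T = "{g \<in> U. g <# H = x}" and g = u]) auto
qed

text \<open>Besides the value, the \<open>has_sum\<close> form is recorded: it certifies summability
  over all cosets, which \<open>infsum\<close> with its default value 0 would hide.\<close>

lemma norm21_finite:
  assumes "finite U" "U \<subseteq> carrier G" "\<And>g. g \<in> carrier G \<Longrightarrow> g \<notin> U \<Longrightarrow> u g = 0"
  shows "((\<lambda>x. (\<Sum>\<^sub>\<infinity>g\<in>x. cmod (u g))\<^sup>2) has_sum
            (\<Sum>x\<in>(\<lambda>g. g <# H) ` U. (\<Sum>g | g \<in> U \<and> g <# H = x. cmod (u g))\<^sup>2)) X"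
    and "norm21 G H u = sqrt (\<Sum>x\<in>(\<lambda>g. g <# H) ` U. (\<Sum>g | g \<in> U \<and> g <# H = x. cmod (u g))\<^sup>2)"
proof -
  have eq: "(\<Sum>\<^sub>\<infinity>g\<in>x. cmod (u g)) = (\<Sum>g | g \<in> U \<and> g <# H = x. cmod (u g))" if "x \<in> X" for x
    using has_sum_coset_finite[of U "\<lambda>g. cmod (u g)"] assms that by (intro infsumI) auto
  have sub: "(\<lambda>g. g <# H) ` U \<subseteq> X" using assms(2) coset_in_X by auto
  have "((\<lambda>x. (\<Sum>g | g \<in> U \<and> g <# H = x. cmod (u g))\<^sup>2) has_sum
            (\<Sum>x\<in>(\<lambda>g. g <# H) ` U. (\<Sum>g | g \<in> U \<and> g <# H = x. cmod (u g))\<^sup>2)) X"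
    using assms(1) sub
    by (intro has_sum_finite_neutralI) (auto intro!: sum.neutral)
  then show *: "((\<lambda>x. (\<Sum>\<^sub>\<infinity>g\<in>x. cmod (u g))\<^sup>2) has_sum
            (\<Sum>x\<in>(\<lambda>g. g <# H) ` U. (\<Sum>g | g \<in> U \<and> g <# H = x. cmod (u g))\<^sup>2)) X"
    using eq by (simp cong: has_sum_cong)
  show "norm21 G H u = sqrt (\<Sum>x\<in>(\<lambda>g. g <# H) ` U. (\<Sum>g | g \<in> U \<and> g <# H = x. cmod (u g))\<^sup>2)"
    unfolding norm21_def using infsumI[OF *] by simp
qed

lemma group_algebra_support:
  assumes "u \<in> group_algebra G"
  obtains U where "finite U" "U \<subseteq> carrier G" "\<And>g. g \<notin> U \<Longrightarrow> u g = 0"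
  using assms by (intro that[of "{g. u g \<noteq> 0}"]) (simp_all add: group_algebra_def)

lemma group_algebraI:
  assumes "finite U" "U \<subseteq> carrier G" "\<And>g. g \<notin> U \<Longrightarrow> u g = 0"
  shows "u \<in> group_algebra G"
proof -
  have sub: "{g. u g \<noteq> 0} \<subseteq> U" using assms(3) by blast
  show ?thesis
    using finite_subset[OF sub assms(1)] subset_trans[OF sub assms(2)] by (simp add: group_algebra_def)
qed

lemma sum_le_norm21:
  assumes "u \<in> group_algebra G" "finite X0" "X0 \<subseteq> X"
  shows "(\<Sum>x\<in>X0. (\<Sum>\<^sub>\<infinity>g\<in>x. cmod (u g))\<^sup>2) \<le> (norm21 G H u)\<^sup>2"
proof -
  obtain U where U: "finite U" "U \<subseteq> carrier G" "\<And>g. g \<notin> U \<Longrightarrow> u g = 0"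
    using group_algebra_support[OF assms(1)] by metis
  have "(norm21 G H u)\<^sup>2 = (\<Sum>x\<in>(\<lambda>g. g <# H) ` U. (\<Sum>g | g \<in> U \<and> g <# H = x. cmod (u g))\<^sup>2)"
    using norm21_finite(2)[of U u] U by (simp add: sum_nonneg)
  moreover have "(\<Sum>x\<in>X0. (\<Sum>\<^sub>\<infinity>g\<in>x. cmod (u g))\<^sup>2) \<le> \<dots>"
    using norm21_finite(1)[of U u] U assms by (intro finite_sum_le_has_sum) auto
  ultimately show ?thesis by simp
qed

lemma has_sum_finite_sum:
  fixes c :: "'i \<Rightarrow> real"
  assumes "finite B" "\<And>y. y \<in> B \<Longrightarrow> (f y has_sum s y) x"
  shows "((\<lambda>z. \<Sum>y\<in>B. c y * f y z) has_sum (\<Sum>y\<in>B. c y * s y)) x"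
  using assms by (induction B) (auto intro!: has_sum_add has_sum_cmult_right)

lemma convolve_finite:
  assumes "finite B" "B \<subseteq> carrier G" "\<And>g. g \<notin> B \<Longrightarrow> f g = 0" "z \<in> carrier G"
  shows "convolve G f \<phi> z = (\<Sum>y\<in>B. f y * \<phi> (inv y \<otimes> z))"
proof -
  have "((\<lambda>y. f y * \<phi> (inv y \<otimes> z)) has_sum (\<Sum>y\<in>B. f y * \<phi> (inv y \<otimes> z))) (carrier G)"
    using assms by (intro has_sum_finite_neutralI) auto
  then show ?thesis using assms(4) by (simp add: convolve_def infsumI)
qed

lemma convolve_group_algebra:
  assumes f: "f \<in> group_algebra G" and \<phi>: "\<phi> \<in> group_algebra G"
  shows "convolve G f \<phi> \<in> group_algebra G"
proof -
  obtain B where B: "finite B" "B \<subseteq> carrier G" "\<And>g. g \<notin> B \<Longrightarrow> f g = 0"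
    using group_algebra_support[OF f] by metis
  obtain U where U: "finite U" "U \<subseteq> carrier G" "\<And>g. g \<notin> U \<Longrightarrow> \<phi> g = 0"
    using group_algebra_support[OF \<phi>] by metis
  show ?thesis
  proof (rule group_algebraI)
    show "finite ((\<lambda>(y, g). y \<otimes> g) ` (B \<times> U))" using B U by auto
    show "(\<lambda>(y, g). y \<otimes> g) ` (B \<times> U) \<subseteq> carrier G" using B U by auto
    fix z assume z: "z \<notin> (\<lambda>(y, g). y \<otimes> g) ` (B \<times> U)"
    show "convolve G f \<phi> z = 0"
    proof (cases "z \<in> carrier G")
      case True
      have "\<phi> (inv y \<otimes> z) = 0" if "y \<in> B" for y
      proof -
        have "z = y \<otimes> (inv y \<otimes> z)" using that B True
          by (simp add: m_assoc[symmetric] subset_iff)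
        then have "inv y \<otimes> z \<notin> U" using z that by (auto simp: image_iff)
        then show ?thesis by (rule U(3))
      qed
      then show ?thesis using convolve_finite[OF B True] by simp
    qed (simp add: convolve_def)
  qed
qed

lemma has_sum_shift:
  assumes \<phi>: "\<phi> \<in> group_algebra G" and y: "y \<in> carrier G" and x: "x \<in> X"
  shows "((\<lambda>z. cmod (\<phi> (inv y \<otimes> z))) has_sum (\<Sum>\<^sub>\<infinity>g\<in>inv y <# x. cmod (\<phi> g))) x"
proof -
  obtain U where U: "finite U" "U \<subseteq> carrier G" "\<And>g. g \<notin> U \<Longrightarrow> \<phi> g = 0"
    using group_algebra_support[OF \<phi>] by metis
  have "((\<lambda>g. cmod (\<phi> g)) has_sum (\<Sum>\<^sub>\<infinity>g\<in>inv y <# x. cmod (\<phi> g))) (inv y <# x)"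
    using has_sum_coset_finite[of U "\<lambda>g. cmod (\<phi> g)" "inv y <# x"] U x y act_X
    by (intro has_sum_infsum) (auto simp: summable_on_def)
  then show ?thesis
    using has_sum_reindex_bij_betw[OF act_mult_bij[of "inv y" x], of "\<lambda>g. cmod (\<phi> g)"] x y by simp
qed

text \<open>Triangle inequality inside the coset; left multiplication by \<open>inv y\<close>
  carries \<open>x\<close> onto the coset \<open>inv y <# x\<close>, so each term contributes a
  translated coset mass of \<open>\<phi>\<close>.\<close>

lemma convolve_coset_le:
  assumes f: "f \<in> group_algebra G" and \<phi>: "\<phi> \<in> group_algebra G"
    and B: "finite B" "B \<subseteq> carrier G" "\<And>g. g \<notin> B \<Longrightarrow> f g = 0" and x: "x \<in> X"
  shows "(\<Sum>\<^sub>\<infinity>z\<in>x. cmod (convolve G f \<phi> z)) \<le> (\<Sum>y\<in>B. cmod (f y) * (\<Sum>\<^sub>\<infinity>g\<in>inv y <# x. cmod (\<phi> g)))"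
proof -
  have R: "((\<lambda>z. \<Sum>y\<in>B. cmod (f y) * cmod (\<phi> (inv y \<otimes> z))) has_sum
      (\<Sum>y\<in>B. cmod (f y) * (\<Sum>\<^sub>\<infinity>g\<in>inv y <# x. cmod (\<phi> g)))) x"
    using B x by (intro has_sum_finite_sum has_sum_shift \<phi>) auto
  have "convolve G f \<phi> \<in> group_algebra G" using convolve_group_algebra f \<phi> .
  then obtain U where U: "finite U" "U \<subseteq> carrier G" "\<And>g. g \<notin> U \<Longrightarrow> convolve G f \<phi> g = 0"
    using group_algebra_support[of "convolve G f \<phi>"] by metis
  have L: "((\<lambda>z. cmod (convolve G f \<phi> z)) has_sum (\<Sum>\<^sub>\<infinity>z\<in>x. cmod (convolve G f \<phi> z))) x"
    using has_sum_coset_finite[of U "\<lambda>g. cmod (convolve G f \<phi> g)" x] U x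
    by (intro has_sum_infsum) (auto simp: summable_on_def)
  show ?thesis
  proof (rule has_sum_mono[OF L R])
    fix z assume "z \<in> x"
    then have "z \<in> carrier G" using x X_carrier by blast
    then show "cmod (convolve G f \<phi> z) \<le> (\<Sum>y\<in>B. cmod (f y) * cmod (\<phi> (inv y \<otimes> z)))"
      by (subst convolve_finite[OF B]) (auto intro!: sum_norm_le simp: norm_mult)
  qed
qed

text \<open>Left translation permutes the cosets, so the translated coset masses are again distinct
  terms of the series for the norm.\<close>

lemma sum_act_le:
  assumes "finite X0" "X0 \<subseteq> X" "y \<in> carrier G" "\<phi> \<in> group_algebra G"
  shows "(\<Sum>x\<in>X0. (\<Sum>\<^sub>\<infinity>g\<in>inv y <# x. cmod (\<phi> g))\<^sup>2) \<le> (norm21 G H \<phi>)\<^sup>2"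
proof -
  have "(\<Sum>x\<in>X0. (\<Sum>\<^sub>\<infinity>g\<in>inv y <# x. cmod (\<phi> g))\<^sup>2) = (\<Sum>x\<in>(\<lambda>x. inv y <# x) ` X0. (\<Sum>\<^sub>\<infinity>g\<in>x. cmod (\<phi> g))\<^sup>2)"
    using assms inj_act[of "inv y"] by (subst sum.reindex) (auto intro: inj_on_subset)
  also have "\<dots> \<le> (norm21 G H \<phi>)\<^sup>2" using assms act_X by (intro sum_le_norm21) auto
  finally show ?thesis .
qed

text \<open>A real supremum dominates its elements only when the set is bounded, and the work lies
  there. Cauchy-Schwarz over the support of \<open>f\<close> gives a crude bound that does not
  depend on \<open>\<psi>\<close>.\<close>

lemma norm_h_upper:
  assumes f: "f \<in> group_algebra G" and \<phi>: "\<phi> \<in> group_algebra G" "norm21 G H \<phi> = 1"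
  shows "norm21 G H (convolve G f \<phi>) \<le> norm_h G H f"
proof -
  obtain B where B: "finite B" "B \<subseteq> carrier G" "\<And>g. g \<notin> B \<Longrightarrow> f g = 0"
    using group_algebra_support[OF f] by metis
  have "norm21 G H (convolve G f \<psi>) \<le> sqrt ((\<Sum>y\<in>B. (cmod (f y))\<^sup>2) * real (card B))"
    if \<psi>: "\<psi> \<in> group_algebra G" "norm21 G H \<psi> = 1" for \<psi>
    unfolding norm21_def
  proof (rule real_sqrt_le_mono)
    obtain U where U: "finite U" "U \<subseteq> carrier G" "\<And>g. g \<notin> U \<Longrightarrow> convolve G f \<psi> g = 0"
      using group_algebra_support[OF convolve_group_algebra[OF f \<psi>(1)]] by metis
    have s: "(\<lambda>x. (\<Sum>\<^sub>\<infinity>g\<in>x. cmod (convolve G f \<psi> g))\<^sup>2) summable_on X"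
      using norm21_finite(1)[of U] U by (auto simp: summable_on_def)
    show "(\<Sum>\<^sub>\<infinity>x\<in>X. (\<Sum>\<^sub>\<infinity>g\<in>x. cmod (convolve G f \<psi> g))\<^sup>2) \<le> (\<Sum>y\<in>B. (cmod (f y))\<^sup>2) * real (card B)"
    proof (rule infsum_le_finite_sums[OF s])
      fix X0 assume X0: "finite X0" "X0 \<subseteq> X"
      have "(\<Sum>x\<in>X0. (\<Sum>\<^sub>\<infinity>g\<in>x. cmod (convolve G f \<psi> g))\<^sup>2)
         \<le> (\<Sum>x\<in>X0. (\<Sum>y\<in>B. (cmod (f y))\<^sup>2) * (\<Sum>y\<in>B. (\<Sum>\<^sub>\<infinity>g\<in>inv y <# x. cmod (\<psi> g))\<^sup>2))"
      proof (rule sum_mono)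
        fix x assume x: "x \<in> X0"
        have "(\<Sum>\<^sub>\<infinity>g\<in>x. cmod (convolve G f \<psi> g))\<^sup>2 \<le> (\<Sum>y\<in>B. cmod (f y) * (\<Sum>\<^sub>\<infinity>g\<in>inv y <# x. cmod (\<psi> g)))\<^sup>2"
          using convolve_coset_le[OF f \<psi>(1) B] x X0 by (intro power_mono) (auto intro: infsum_nonneg)
        also have "\<dots> \<le> (\<Sum>y\<in>B. (cmod (f y))\<^sup>2) * (\<Sum>y\<in>B. (\<Sum>\<^sub>\<infinity>g\<in>inv y <# x. cmod (\<psi> g))\<^sup>2)"
          by (rule Cauchy_Schwarz_ineq_sum)
        finally show "(\<Sum>\<^sub>\<infinity>g\<in>x. cmod (convolve G f \<psi> g))\<^sup>2
          \<le> (\<Sum>y\<in>B. (cmod (f y))\<^sup>2) * (\<Sum>y\<in>B. (\<Sum>\<^sub>\<infinity>g\<in>inv y <# x. cmod (\<psi> g))\<^sup>2)" .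
      qed
      also have "\<dots> = (\<Sum>y\<in>B. (cmod (f y))\<^sup>2) * (\<Sum>y\<in>B. \<Sum>x\<in>X0. (\<Sum>\<^sub>\<infinity>g\<in>inv y <# x. cmod (\<psi> g))\<^sup>2)"
        by (subst sum.swap) (simp add: sum_distrib_left)
      also have "\<dots> \<le> (\<Sum>y\<in>B. (cmod (f y))\<^sup>2) * (\<Sum>y\<in>B. 1)"
        using sum_act_le[OF X0 _ \<psi>(1)] \<psi>(2) B by (intro mult_left_mono sum_mono sum_nonneg) auto
      finally show "(\<Sum>x\<in>X0. (\<Sum>\<^sub>\<infinity>g\<in>x. cmod (convolve G f \<psi> g))\<^sup>2) \<le> (\<Sum>y\<in>B. (cmod (f y))\<^sup>2) * real (card B)"
        by simp
    qed
  qed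
  then have "bdd_above {norm21 G H (convolve G f \<psi>) | \<psi>. \<psi> \<in> group_algebra G \<and> norm21 G H \<psi> = 1}"
    by (intro bdd_aboveI) auto
  then show ?thesis unfolding norm_h_def using \<phi> by (intro cSup_upper) auto
qed

text \<open>Turns rapid decay, a statement about convolution on G, into an l^2 bound for averages of
  a function \<open>\<Psi>\<close> on cosets. \<open>\<Psi>\<close> is lifted to G by putting its
  whole value at one representative of each coset; since everything is nonnegative, nothing cancels,
  and the coset masses of the convolution are exactly the averages.\<close>

lemma rapid_decay_finite:
  assumes rd: "pair_rapid_decay G H l C s" and B: "finite B" "B \<subseteq> carrier G"
    and b: "\<And>g. g \<in> B \<Longrightarrow> b g \<ge> 0"
    and X0: "finite X0" "X0 \<subseteq> X" and Y: "finite Y" "Y \<subseteq> X"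
    and cover: "\<And>g x. g \<in> B \<Longrightarrow> x \<in> X0 \<Longrightarrow> inv g <# x \<in> Y"
    and \<Psi>: "\<And>y. y \<in> Y \<Longrightarrow> \<Psi> y \<ge> (0::real)"
  shows "(\<Sum>x\<in>X0. (\<Sum>g\<in>B. b g * \<Psi> (inv g <# x))\<^sup>2)
    \<le> C\<^sup>2 * (\<Sum>z\<in>(\<lambda>g. g <# H) ` B. (\<Sum>g | g \<in> B \<and> g <# H = z. b g * (1 + real (l g)) powr s)\<^sup>2) * (\<Sum>y\<in>Y. (\<Psi> y)\<^sup>2)"
\<comment> \<open>\<open>norm_h\<close> only tests functions of norm 1, so \<open>\<Psi>\<close>
  must be divided by its norm \<open>N\<close>; a vanishing \<open>\<Psi>\<close> is treated
  apart.\<close>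
proof (cases "(\<Sum>y\<in>Y. (\<Psi> y)\<^sup>2) = 0")
  case True
  then have "\<Psi> y = 0" if "y \<in> Y" for y using Y that by (auto simp: sum_nonneg_eq_0_iff)
  then have "(\<Sum>x\<in>X0. (\<Sum>g\<in>B. b g * \<Psi> (inv g <# x))\<^sup>2) = 0" using cover by (intro sum.neutral) auto
  then show ?thesis using True by simp
next
  case False
  define N where "N = sqrt (\<Sum>y\<in>Y. (\<Psi> y)\<^sup>2)"
  have N: "N > 0" "N\<^sup>2 = (\<Sum>y\<in>Y. (\<Psi> y)\<^sup>2)"
    using False sum_nonneg[of Y "\<lambda>y. (\<Psi> y)\<^sup>2"] by (auto simp: N_def less_le)
  define f where "f g = complex_of_real (if g \<in> B then b g else 0)" for g
  define r where "r x = (SOME g. g \<in> x)" for x :: "'a set"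
  have r: "r x \<in> x" if "x \<in> X" for x unfolding r_def using coset_nonempty[OF that] by (rule someI_ex)
  have r': "r x \<in> carrier G" "r x <# H = x" if "x \<in> X" for x
    using r[OF that] X_carrier[OF that] mem_coset_iff[OF that] by auto
  define \<phi> where "\<phi> g = complex_of_real (if g <# H \<in> Y \<and> g = r (g <# H) then \<Psi> (g <# H) / N else 0)" for g
  have fB: "f g = 0" if "g \<notin> B" for g using that by (simp add: f_def)
  have fga: "f \<in> group_algebra G" using B fB by (rule group_algebraI)
  have U: "finite (r ` Y)" "r ` Y \<subseteq> carrier G" using Y r' by auto
  have \<phi>0: "\<phi> g = 0" if "g \<notin> r ` Y" for g using that by (auto simp: \<phi>_def)
  have \<phi>ga: "\<phi> \<in> group_algebra G" using U \<phi>0 by (rule group_algebraI)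
  have \<phi>c: "((\<lambda>g. cmod (\<phi> g)) has_sum \<Psi> x / N) x" if "x \<in> Y" for x
  proof (rule has_sum_finite_neutralI[of "{r x}"])
    show "{r x} \<subseteq> x" using that Y r by auto
    show "cmod (\<phi> g) = 0" if "g \<in> x - {r x}" for g
    proof -
      have "g <# H = x" using that \<open>x \<in> Y\<close> Y mem_coset_iff X_carrier by blast
      then show ?thesis using that by (simp add: \<phi>_def)
    qed
    show "\<Psi> x / N = (\<Sum>g\<in>{r x}. cmod (\<phi> g))" using that Y r' N \<Psi> by (auto simp: \<phi>_def)
  qed auto
  have im: "(\<lambda>g. g <# H) ` (r ` Y) = Y" using r'(2) Y by (simp add: image_image subset_iff)
  have "(\<Sum>g | g \<in> r ` Y \<and> g <# H = x. cmod (\<phi> g)) = \<Psi> x / N" if "x \<in> Y" for x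
    using has_sum_coset_finite[of "r ` Y" "\<lambda>g. cmod (\<phi> g)" x] U \<phi>0 \<phi>c[OF that] Y that has_sum_unique
    by (metis (no_types, lifting) norm_zero subsetD)
  then have "norm21 G H \<phi> = sqrt (\<Sum>x\<in>Y. (\<Psi> x / N)\<^sup>2)"
    using norm21_finite(2)[OF U, of \<phi>] \<phi>0 im by simp
  also have "\<dots> = 1" using N False by (simp add: power_divide sum_divide_distrib[symmetric])
  finally have \<phi>1: "norm21 G H \<phi> = 1" .
  \<comment> \<open>An equality, unlike \<open>convolve_coset_le\<close>: all terms of the
    convolution are nonnegative reals.\<close>
  have conv: "(\<Sum>\<^sub>\<infinity>z\<in>x. cmod (convolve G f \<phi> z)) = (\<Sum>g\<in>B. b g * \<Psi> (inv g <# x)) / N" if x: "x \<in> X0" for x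
  proof -
    have xX: "x \<in> X" using x X0 by auto
    have inner: "(\<Sum>\<^sub>\<infinity>g\<in>inv y <# x. cmod (\<phi> g)) = \<Psi> (inv y <# x) / N" if "y \<in> B" for y
      using \<phi>c[OF cover[OF that x]] by (rule infsumI)
    have "((\<lambda>z. \<Sum>y\<in>B. b y * cmod (\<phi> (inv y \<otimes> z))) has_sum (\<Sum>y\<in>B. b y * (\<Psi> (inv y <# x) / N))) x"
    proof (rule has_sum_finite_sum[OF B(1)])
      fix y assume y: "y \<in> B"
      show "((\<lambda>z. cmod (\<phi> (inv y \<otimes> z))) has_sum (\<Psi> (inv y <# x) / N)) x"
        using has_sum_shift[OF \<phi>ga _ xX, of y] y B unfolding inner[OF y] by auto
    qed
    moreover have "cmod (convolve G f \<phi> z) = (\<Sum>y\<in>B. b y * cmod (\<phi> (inv y \<otimes> z)))" if "z \<in> x" for z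
    proof -
      have "z \<in> carrier G" using that xX X_carrier by blast
      then have "convolve G f \<phi> z = (\<Sum>y\<in>B. f y * \<phi> (inv y \<otimes> z))" using convolve_finite[OF B fB] by simp
      also have "\<dots> = complex_of_real (\<Sum>y\<in>B. b y * cmod (\<phi> (inv y \<otimes> z)))"
        using \<Psi> N by (auto simp: f_def \<phi>_def intro!: sum.cong)
      also have "cmod \<dots> = (\<Sum>y\<in>B. b y * cmod (\<phi> (inv y \<otimes> z)))"
        using b by (simp only: norm_of_real) (intro abs_of_nonneg sum_nonneg mult_nonneg_nonneg; simp)
      finally show ?thesis .
    qed
    ultimately have "((\<lambda>z. cmod (convolve G f \<phi> z)) has_sum (\<Sum>y\<in>B. b y * (\<Psi> (inv y <# x) / N))) x"
      by (simp cong: has_sum_cong)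
    then show ?thesis by (simp add: infsumI sum_divide_distrib)
  qed
  define w where "w g = f g * of_real ((1 + real (l g)) powr s)" for g
  have C: "C > 0" using rd by (simp add: pair_rapid_decay_def)
  have "norm21 G H (convolve G f \<phi>) \<le> norm_h G H f" using norm_h_upper fga \<phi>ga \<phi>1 .
  also have "\<dots> \<le> C * norm21 G H w" using rd fga by (simp add: pair_rapid_decay_def w_def[abs_def])
  finally have le: "norm21 G H (convolve G f \<phi>) \<le> C * norm21 G H w" .
  have "(\<Sum>x\<in>X0. (\<Sum>g\<in>B. b g * \<Psi> (inv g <# x))\<^sup>2) = N\<^sup>2 * (\<Sum>x\<in>X0. (\<Sum>\<^sub>\<infinity>z\<in>x. cmod (convolve G f \<phi> z))\<^sup>2)"
    using N False by (simp add: conv power_divide sum_divide_distrib[symmetric])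
  also have "\<dots> \<le> N\<^sup>2 * (norm21 G H (convolve G f \<phi>))\<^sup>2"
    using X0 by (intro mult_left_mono sum_le_norm21 convolve_group_algebra fga \<phi>ga) auto
  also have "\<dots> \<le> N\<^sup>2 * (C * norm21 G H w)\<^sup>2"
    using le by (intro mult_left_mono power_mono) (auto simp: norm21_def intro!: infsum_nonneg)
  also have "(norm21 G H w)\<^sup>2 = (\<Sum>z\<in>(\<lambda>g. g <# H) ` B. (\<Sum>g | g \<in> B \<and> g <# H = z. cmod (w g))\<^sup>2)"
    by (subst norm21_finite(2)[OF B]) (auto simp: w_def fB sum_nonneg)
  then have "N\<^sup>2 * (C * norm21 G H w)\<^sup>2 = C\<^sup>2 * (\<Sum>z\<in>(\<lambda>g. g <# H) ` B. (\<Sum>g | g \<in> B \<and> g <# H = z. cmod (w g))\<^sup>2) * N\<^sup>2"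
    by (simp add: power_mult_distrib)
  also have "(\<Sum>z\<in>(\<lambda>g. g <# H) ` B. (\<Sum>g | g \<in> B \<and> g <# H = z. cmod (w g))\<^sup>2)
     = (\<Sum>z\<in>(\<lambda>g. g <# H) ` B. (\<Sum>g | g \<in> B \<and> g <# H = z. b g * (1 + real (l g)) powr s)\<^sup>2)"
    using b by (auto intro!: sum.cong arg_cong[where f = "\<lambda>t. t\<^sup>2"] simp: w_def f_def norm_mult)
  finally show ?thesis using N by simp
qed

end

section \<open>Interpolated rapid decay\<close>

context coset_space begin

lemma sum_orbit_le:
  assumes "finite Y" "X0 \<subseteq> X" "g \<in> carrier G" "\<And>x. x \<in> X0 \<Longrightarrow> inv g <# x \<in> Y"
    and "\<And>y. y \<in> Y \<Longrightarrow> (0::real) \<le> F y"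
  shows "(\<Sum>x\<in>X0. F (inv g <# x)) \<le> (\<Sum>y\<in>Y. F y)"
proof -
  have "(\<Sum>x\<in>X0. F (inv g <# x)) = (\<Sum>y\<in>(\<lambda>x. inv g <# x) ` X0. F y)"
    using assms(2,3) inj_act[of "inv g"] by (subst sum.reindex) (auto intro: inj_on_subset)
  also have "\<dots> \<le> (\<Sum>y\<in>Y. F y)" using assms by (intro sum_mono2) auto
  finally show ?thesis .
qed

text \<open>Interpolates between averaging on l^1 and rapid decay on l^2: each term is factored as f
  \<Phi> = (f K^e \<Phi>^q)^(1 - t) (b \<Phi>^(q/2))^t, where the first bracket is summed by
  translation invariance and the second by \<open>rapid_decay_finite\<close>. The function
  \<open>\<nu>\<close> merely dominates the coset masses of \<open>f\<close>, because
  \<open>B\<close> will be a finite part of a support while \<open>\<nu>\<close> remains the full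
  law on cosets.\<close>

lemma rapid_decay_interpolation:
  assumes rd: "pair_rapid_decay G H l C s" and e: "0 < e" "e \<le> 1"
    and B: "finite B" "B \<subseteq> carrier G" and f: "\<And>g. g \<in> B \<Longrightarrow> f g > 0"
    and \<nu>: "\<And>g. g \<in> B \<Longrightarrow> (\<Sum>h | h \<in> B \<and> h <# H = g <# H. f h) \<le> \<nu> (g <# H)"
    and X0: "finite X0" "X0 \<subseteq> X" and Y: "finite Y" "Y \<subseteq> X"
    and cover: "\<And>g x. g \<in> B \<Longrightarrow> x \<in> X0 \<Longrightarrow> inv g <# x \<in> Y"
    and \<Phi>: "\<And>y. y \<in> Y \<Longrightarrow> \<Phi> y \<ge> (0::real)"
  shows "(\<Sum>x\<in>X0. (\<Sum>g\<in>B. f g * \<Phi> (inv g <# x)) powr (1 + e))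
    \<le> C powr (2 * e) * (\<Sum>g\<in>B. f g * (\<nu> (g <# H) * (1 + real (l g)) powr (2 * s)) powr e)
        * (\<Sum>y\<in>Y. \<Phi> y powr (1 + e))"
proof -
  \<comment> \<open>\<open>t\<close> solves 1/q = (1 - t) + t/2.\<close>
  define q t where "q = 1 + e" and "t = 2 * e / (1 + e)"
  have t: "0 \<le> t" "t \<le> 1" using e by (auto simp: t_def)
  have qt: "q * (1 - t) = 1 - e" "q * t = 2 * e" using e by (auto simp: q_def t_def field_simps)
  define K where "K g = \<nu> (g <# H) * (1 + real (l g)) powr (2 * s)" for g
  \<comment> \<open>The exponent of \<open>K g\<close> is forced by e (1 - t) - (1 - e) t / 2 = 0:
    the powers of K have to cancel in \<open>split\<close>.\<close>
  define b where "b g = f g * K g powr (- (1 - e) / 2)" for g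
  define P where "P x = (\<Sum>g\<in>B. f g * K g powr e * \<Phi> (inv g <# x) powr q)" for x
  define Q where "Q x = (\<Sum>g\<in>B. b g * \<Phi> (inv g <# x) powr (q / 2))" for x
  define M where "M = (\<Sum>g\<in>B. f g * K g powr e)"
  define A where "A = (\<Sum>y\<in>Y. \<Phi> y powr q)"
  have C: "C > 0" using rd by (simp add: pair_rapid_decay_def)
  have \<nu>pos: "\<nu> (g <# H) > 0" if "g \<in> B" for g
  proof -
    have "0 < f g" using f that .
    also have "\<dots> \<le> (\<Sum>h | h \<in> B \<and> h <# H = g <# H. f h)"
      using B(1) that f by (intro member_le_sum) (auto intro: less_imp_le)
    also have "\<dots> \<le> \<nu> (g <# H)" using \<nu> that .
    finally show ?thesis .
  qed
  have K: "K g > 0" if "g \<in> B" for g using \<nu>pos[OF that] by (simp add: K_def add_pos_nonneg)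
  have b: "b g > 0" if "g \<in> B" for g using f[OF that] K[OF that] by (simp add: b_def)
  have fb0: "f g \<ge> 0" "b g \<ge> 0" if "g \<in> B" for g using f[OF that] b[OF that] by simp_all
  have \<Phi>': "\<Phi> (inv g <# x) \<ge> 0" if "g \<in> B" "x \<in> X0" for g x using that cover \<Phi> by blast
  have P0: "P x \<ge> 0" if "x \<in> X0" for x
    using fb0 unfolding P_def by (intro sum_nonneg mult_nonneg_nonneg) auto
  have Q0: "Q x \<ge> 0" if "x \<in> X0" for x
    using fb0 unfolding Q_def by (intro sum_nonneg mult_nonneg_nonneg) auto
  have M0: "M \<ge> 0" using fb0 unfolding M_def by (intro sum_nonneg mult_nonneg_nonneg) auto
  have A0: "A \<ge> 0" by (auto simp: A_def intro!: sum_nonneg)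
  have split: "f g * \<Phi> (inv g <# x) = (f g * K g powr e * \<Phi> (inv g <# x) powr q) powr (1 - t)
      * (b g * \<Phi> (inv g <# x) powr (q / 2)) powr t" if g: "g \<in> B" and x: "x \<in> X0" for g x
  proof (cases "\<Phi> (inv g <# x) = 0")
    case False
    define p where "p = \<Phi> (inv g <# x)"
    have p: "p > 0" using False \<Phi>'[OF g x] by (simp add: p_def)
    have "(f g * K g powr e * p powr q) powr (1 - t) * (b g * p powr (q / 2)) powr t
      = exp ((ln (f g) + e * ln (K g) + q * ln p) * (1 - t) + (ln (f g) + - (1 - e) / 2 * ln (K g) + q / 2 * ln p) * t)"
    proof -
      have "f g * K g powr e * p powr q = exp (ln (f g) + e * ln (K g) + q * ln p)"
        using f[OF g] K[OF g] p by (simp add: powr_def exp_add)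
      moreover have "b g * p powr (q / 2) = exp (ln (f g) + - (1 - e) / 2 * ln (K g) + q / 2 * ln p)"
        using f[OF g] K[OF g] p unfolding b_def powr_def exp_add by simp
      ultimately show ?thesis by (simp add: powr_def exp_add[symmetric] algebra_simps)
    qed
    also have "(ln (f g) + e * ln (K g) + q * ln p) * (1 - t) + (ln (f g) + - (1 - e) / 2 * ln (K g) + q / 2 * ln p) * t
      = ln (f g) + (e * (1 - t) - (1 - e) / 2 * t) * ln (K g) + (q * (1 - t) + q * t / 2) * ln p"
      by (simp add: algebra_simps add_divide_distrib diff_divide_distrib)
    also have "e * (1 - t) - (1 - e) / 2 * t = 0" using e by (simp add: t_def field_simps)
    also have "q * (1 - t) + q * t / 2 = 1" unfolding qt by simp
    also have "exp (ln (f g) + 0 * ln (K g) + 1 * ln p) = f g * p"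
      using f[OF g] p by (simp add: exp_add)
    finally show ?thesis unfolding p_def by simp
  qed simp
  \<comment> \<open>Hoelder over the group elements; raising to the power q turns the exponents 1 -
    t and t into 1 - e and 2e.\<close>
  have pt: "(\<Sum>g\<in>B. f g * \<Phi> (inv g <# x)) powr q \<le> P x powr (1 - e) * (Q x ^ 2) powr e" if x: "x \<in> X0" for x
  proof -
    have "(\<Sum>g\<in>B. f g * \<Phi> (inv g <# x)) = (\<Sum>g\<in>B. (f g * K g powr e * \<Phi> (inv g <# x) powr q) powr (1 - t)
      * (b g * \<Phi> (inv g <# x) powr (q / 2)) powr t)" using split x by (intro sum.cong) auto
    also have "\<dots> \<le> P x powr (1 - t) * Q x powr t" unfolding P_def Q_def
      using fb0 t by (intro Holder_sum mult_nonneg_nonneg) auto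
    finally have "(\<Sum>g\<in>B. f g * \<Phi> (inv g <# x)) powr q \<le> (P x powr (1 - t) * Q x powr t) powr q"
      using fb0 \<Phi>' x e by (intro powr_mono2 sum_nonneg mult_nonneg_nonneg) (auto simp: q_def)
    also have "\<dots> = P x powr (1 - e) * Q x powr (2 * e)"
      by (simp add: powr_mult powr_powr qt mult.commute[of _ q])
    also have "Q x powr (2 * e) = (Q x ^ 2) powr e"
      using Q0[OF x] by (cases "Q x = 0") (auto simp: powr_powr[symmetric])
    finally show ?thesis .
  qed
  have sumP: "(\<Sum>x\<in>X0. P x) \<le> M * A"
  proof -
    have "(\<Sum>x\<in>X0. P x) = (\<Sum>g\<in>B. f g * K g powr e * (\<Sum>x\<in>X0. \<Phi> (inv g <# x) powr q))"
      unfolding P_def by (subst sum.swap) (simp add: sum_distrib_left)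
    also have "\<dots> \<le> (\<Sum>g\<in>B. f g * K g powr e * A)" unfolding A_def
      using fb0 B Y X0 cover
      by (intro sum_mono mult_left_mono sum_orbit_le[where F = "\<lambda>y. \<Phi> y powr q"] mult_nonneg_nonneg) auto
    finally show ?thesis by (simp add: M_def sum_distrib_right)
  qed
  \<comment> \<open>Cauchy-Schwarz within a coset, with f = sqrt f * sqrt f: one factor is the coset
    mass, at most \<open>\<nu> z\<close>, and this completes K^(e - 1) (1 + l)^(2s) to K^e. So the
    same \<open>M\<close> bounds both brackets.\<close>
  have D: "(\<Sum>z\<in>(\<lambda>g. g <# H) ` B. (\<Sum>g | g \<in> B \<and> g <# H = z. b g * (1 + real (l g)) powr s)\<^sup>2) \<le> M"
  proof -
    have "(\<Sum>g | g \<in> B \<and> g <# H = z. b g * (1 + real (l g)) powr s)\<^sup>2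
      \<le> (\<Sum>g | g \<in> B \<and> g <# H = z. f g * K g powr e)" if z: "z \<in> (\<lambda>g. g <# H) ` B" for z
    proof -
      let ?B = "{g. g \<in> B \<and> g <# H = z}"
      obtain g0 where g0: "g0 \<in> B" "z = g0 <# H" using z by auto
      have "(\<Sum>g\<in>?B. b g * (1 + real (l g)) powr s)
          = (\<Sum>g\<in>?B. sqrt (f g) * (sqrt (f g) * K g powr (- (1 - e) / 2) * (1 + real (l g)) powr s))"
        using f by (intro sum.cong) (auto simp: b_def less_imp_le)
      then have "(\<Sum>g\<in>?B. b g * (1 + real (l g)) powr s)\<^sup>2
        \<le> (\<Sum>g\<in>?B. (sqrt (f g))\<^sup>2) * (\<Sum>g\<in>?B. (sqrt (f g) * K g powr (- (1 - e) / 2) * (1 + real (l g)) powr s)\<^sup>2)"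
        by (simp only: Cauchy_Schwarz_ineq_sum)
      also have "(\<Sum>g\<in>?B. (sqrt (f g))\<^sup>2) = (\<Sum>g\<in>?B. f g)"
        using f by (intro sum.cong) (auto simp: less_imp_le)
      also have "(\<Sum>g\<in>?B. f g) * (\<Sum>g\<in>?B. (sqrt (f g) * K g powr (- (1 - e) / 2) * (1 + real (l g)) powr s)\<^sup>2)
        \<le> \<nu> z * (\<Sum>g\<in>?B. (sqrt (f g) * K g powr (- (1 - e) / 2) * (1 + real (l g)) powr s)\<^sup>2)"
        using \<nu>[OF g0(1)] g0 by (intro mult_right_mono sum_nonneg) auto
      also have "\<dots> = (\<Sum>g\<in>?B. f g * K g powr e)" unfolding sum_distrib_left
      proof (rule sum.cong[OF refl])
        fix g assume "g \<in> ?B"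
        then have g: "g \<in> B" "g <# H = z" by auto
        let ?k = "K g powr (- (1 - e) / 2)" and ?w = "(1 + real (l g)) powr s"
        have "\<nu> z * (sqrt (f g) * ?k * ?w)\<^sup>2 = f g * (?k * ?k) * (\<nu> z * (?w * ?w))"
          using fb0(1)[OF g(1)] by (simp add: power_mult_distrib power2_eq_square)
        also have "?k * ?k = K g powr (e - 1)"
        proof -
          have "- (1 - e) / 2 + - (1 - e) / 2 = e - 1" by argo
          then show ?thesis by (simp only: powr_add[symmetric])
        qed
        also have "?w * ?w = (1 + real (l g)) powr (2 * s)" unfolding powr_add[symmetric] by simp
        also have "\<nu> z * (1 + real (l g)) powr (2 * s) = K g" using g by (simp add: K_def)
        also have "f g * K g powr (e - 1) * K g = f g * K g powr e"
          using K[OF g(1)] by (simp add: powr_diff)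
        finally show "\<nu> z * (sqrt (f g) * ?k * ?w)\<^sup>2 = f g * K g powr e" .
      qed
      finally show ?thesis .
    qed
    then have "(\<Sum>z\<in>(\<lambda>g. g <# H) ` B. (\<Sum>g | g \<in> B \<and> g <# H = z. b g * (1 + real (l g)) powr s)\<^sup>2)
      \<le> (\<Sum>z\<in>(\<lambda>g. g <# H) ` B. \<Sum>g | g \<in> B \<and> g <# H = z. f g * K g powr e)" by (rule sum_mono)
    also have "\<dots> = M" unfolding M_def using B(1) by (rule sum.image_gen[symmetric])
    finally show ?thesis .
  qed
  have sumQ: "(\<Sum>x\<in>X0. (Q x)\<^sup>2) \<le> C\<^sup>2 * (M * A)"
  proof -
    have "(\<Sum>x\<in>X0. (Q x)\<^sup>2) \<le> C\<^sup>2 * (\<Sum>z\<in>(\<lambda>g. g <# H) ` B. (\<Sum>g | g \<in> B \<and> g <# H = z. b g * (1 + real (l g)) powr s)\<^sup>2)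
        * (\<Sum>y\<in>Y. (\<Phi> y powr (q / 2))\<^sup>2)"
      unfolding Q_def using X0 Y cover B
      by (intro rapid_decay_finite[OF rd, where \<Psi> = "\<lambda>y. \<Phi> y powr (q / 2)"]) (use fb0 in auto)
    also have "(\<Sum>y\<in>Y. (\<Phi> y powr (q / 2))\<^sup>2) = A" unfolding A_def
      by (intro sum.cong) (auto simp: power2_eq_square powr_add[symmetric])
    also have "C\<^sup>2 * (\<Sum>z\<in>(\<lambda>g. g <# H) ` B. (\<Sum>g | g \<in> B \<and> g <# H = z. b g * (1 + real (l g)) powr s)\<^sup>2) * A
       \<le> C\<^sup>2 * M * A" using A0 D by (intro mult_right_mono mult_left_mono) auto
    finally show ?thesis by simp
  qed
  have "(\<Sum>x\<in>X0. (\<Sum>g\<in>B. f g * \<Phi> (inv g <# x)) powr (1 + e)) \<le> (\<Sum>x\<in>X0. P x powr (1 - e) * (Q x ^ 2) powr e)"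
    unfolding q_def[symmetric] by (rule sum_mono[OF pt])
  \<comment> \<open>Hoelder a second time, now over the cosets, with weights 1 - e and e.\<close>
  also have "\<dots> \<le> (\<Sum>x\<in>X0. P x) powr (1 - e) * (\<Sum>x\<in>X0. Q x ^ 2) powr e"
    using e P0 by (intro Holder_sum) auto
  also have "\<dots> \<le> (M * A) powr (1 - e) * (C\<^sup>2 * (M * A)) powr e"
    using sumP sumQ e P0 by (intro mult_mono powr_mono2) (auto intro!: sum_nonneg)
  also have "\<dots> = C powr (2 * e) * ((M * A) powr (1 - e) * (M * A) powr e)"
    using C M0 A0 by (simp add: powr_mult powr_powr[symmetric])
  also have "(M * A) powr (1 - e) * (M * A) powr e = M * A"
    using M0 A0 by (simp add: powr_add[symmetric] powr_one')
  finally show ?thesis unfolding M_def A_def K_def q_def by (simp add: mult.assoc)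
qed

text \<open>Jensen for the power 1 + e, derived from Hoelder because \<open>f\<close> has mass at
  most 1, followed by translation invariance. It supplies the a priori boundedness of the operator,
  on which the meaning of the supremum in \<open>lq_opnorm\<close> depends.\<close>

lemma sum_contraction:
  assumes e: "0 < e"
    and B: "finite B" "B \<subseteq> carrier G" and f: "\<And>g. g \<in> B \<Longrightarrow> f g > 0" and f1: "sum f B \<le> 1"
    and X0: "finite X0" "X0 \<subseteq> X" and Y: "finite Y" "Y \<subseteq> X"
    and cover: "\<And>g x. g \<in> B \<Longrightarrow> x \<in> X0 \<Longrightarrow> inv g <# x \<in> Y"
    and \<Phi>: "\<And>y. y \<in> Y \<Longrightarrow> \<Phi> y \<ge> (0::real)"
  shows "(\<Sum>x\<in>X0. (\<Sum>g\<in>B. f g * \<Phi> (inv g <# x)) powr (1 + e)) \<le> (\<Sum>y\<in>Y. \<Phi> y powr (1 + e))"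
proof -
  define t where "t = 1 / (1 + e)"
  have t: "0 \<le> t" "t \<le> 1" "t * (1 + e) = 1" using e by (auto simp: t_def)
  have fg0: "f g \<ge> 0" if "g \<in> B" for g using f[OF that] by simp
  have f0: "sum f B \<ge> 0" using fg0 by (rule sum_nonneg)
  have \<Phi>': "\<Phi> (inv g <# x) \<ge> 0" if "g \<in> B" "x \<in> X0" for g x using that cover \<Phi> by blast
  have "(\<Sum>g\<in>B. f g * \<Phi> (inv g <# x)) powr (1 + e) \<le> (\<Sum>g\<in>B. f g * \<Phi> (inv g <# x) powr (1 + e))"
    if x: "x \<in> X0" for x
  proof -
    let ?S = "\<Sum>g\<in>B. f g * \<Phi> (inv g <# x) powr (1 + e)"
    have S0: "?S \<ge> 0" using fg0 by (intro sum_nonneg mult_nonneg_nonneg) auto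
    have "f g * \<Phi> (inv g <# x) = f g powr (1 - t) * (f g * \<Phi> (inv g <# x) powr (1 + e)) powr t" if "g \<in> B" for g
    proof -
      have "f g powr (1 - t) * (f g * \<Phi> (inv g <# x) powr (1 + e)) powr t
        = (f g powr (1 - t) * f g powr t) * \<Phi> (inv g <# x) powr (t * (1 + e))"
        using f[OF that] by (simp add: powr_mult powr_powr mult.commute)
      also have "\<dots> = f g * \<Phi> (inv g <# x)"
        using f[OF that] \<Phi>'[OF that x] t by (simp add: powr_add[symmetric] powr_one')
      finally show ?thesis by simp
    qed
    then have "(\<Sum>g\<in>B. f g * \<Phi> (inv g <# x)) = (\<Sum>g\<in>B. f g powr (1 - t) * (f g * \<Phi> (inv g <# x) powr (1 + e)) powr t)"
      by (rule sum.cong[OF refl])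
    also have "\<dots> \<le> sum f B powr (1 - t) * ?S powr t"
      using fg0 t by (intro Holder_sum) auto
    also have "\<dots> \<le> 1 * ?S powr t" using f1 t f0 by (intro mult_right_mono powr_le1) auto
    finally have "(\<Sum>g\<in>B. f g * \<Phi> (inv g <# x)) powr (1 + e) \<le> (?S powr t) powr (1 + e)"
      using fg0 \<Phi>' x e by (intro powr_mono2 sum_nonneg mult_nonneg_nonneg) auto
    also have "\<dots> = ?S" using t S0 by (simp add: powr_powr powr_one')
    finally show ?thesis .
  qed
  then have "(\<Sum>x\<in>X0. (\<Sum>g\<in>B. f g * \<Phi> (inv g <# x)) powr (1 + e))
    \<le> (\<Sum>x\<in>X0. \<Sum>g\<in>B. f g * \<Phi> (inv g <# x) powr (1 + e))" by (rule sum_mono)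
  also have "\<dots> = (\<Sum>g\<in>B. f g * (\<Sum>x\<in>X0. \<Phi> (inv g <# x) powr (1 + e)))"
    by (subst sum.swap) (simp add: sum_distrib_left)
  also have "\<dots> \<le> (\<Sum>g\<in>B. f g * (\<Sum>y\<in>Y. \<Phi> y powr (1 + e)))"
    using fg0 B Y X0 cover
    by (intro sum_mono mult_left_mono sum_orbit_le[where F = "\<lambda>y. \<Phi> y powr (1 + e)"]) auto
  also have "\<dots> = sum f B * (\<Sum>y\<in>Y. \<Phi> y powr (1 + e))" by (simp add: sum_distrib_right)
  also have "\<dots> \<le> 1 * (\<Sum>y\<in>Y. \<Phi> y powr (1 + e))" using f1 by (intro mult_right_mono sum_nonneg) auto
  finally show ?thesis by simp
qed

end

section \<open>The averaging operator on the coset space\<close>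

text \<open>Bridge from Bochner integrals, in which the estimates are made, to
  \<open>infsum\<close>, in which the operator is defined.\<close>

lemma has_sum_expectation_pmf:
  fixes f :: "'x \<Rightarrow> real"
  assumes "integrable (measure_pmf p) f"
  shows "((\<lambda>x. pmf p x * f x) has_sum measure_pmf.expectation p f) UNIV"
proof -
  have int: "integrable (count_space UNIV) (\<lambda>x. pmf p x * f x)"
    using assms unfolding measure_pmf_eq_density by (subst (asm) integrable_density) auto
  have "(\<lambda>x. norm (pmf p x * f x)) summable_on UNIV"
    using int abs_summable_equivalent[of "\<lambda>x. pmf p x * f x" UNIV]
    by (simp add: Infinite_Set_Sum.abs_summable_on_def)
  moreover from int have "infsum (\<lambda>x. pmf p x * f x) UNIV = measure_pmf.expectation p f"
    by (subst infsetsum_infsum[symmetric])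
       (simp_all add: pmf_expectation_eq_infsetsum Infinite_Set_Sum.abs_summable_on_def)
  ultimately show ?thesis by (metis abs_summable_summable has_sum_infsum)
qed

lemma has_sum_expectation_set_pmf:
  fixes f :: "'x \<Rightarrow> real"
  assumes "integrable (measure_pmf p) f" "set_pmf p \<subseteq> A"
  shows "((\<lambda>x. pmf p x * f x) has_sum measure_pmf.expectation p f) A"
  using has_sum_expectation_pmf[OF assms(1)] assms(2)
  by (subst has_sum_cong_neutral[where T = UNIV and g = "\<lambda>x. pmf p x * f x"])
     (auto simp: set_pmf_iff)

lemma integrable_pmf_bounded:
  fixes f :: "'x \<Rightarrow> real"
  assumes "\<And>x. x \<in> set_pmf p \<Longrightarrow> \<bar>f x\<bar> \<le> c"
  shows "integrable (measure_pmf p) f"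
  using assms by (intro measure_pmf.integrable_const_bound[where B = c]) (auto simp: AE_measure_pmf_iff)

text \<open>Valid for every \<open>\<eta>\<close>: a series that is not summable has
  \<open>infsum\<close> equal to 0, and the right side may be infinite. In this form the estimate
  can be iterated without tracking summability.\<close>

lemma norm_infsum_pmf_le:
  fixes \<eta> :: "'x \<Rightarrow> complex"
  shows "ennreal (cmod (\<Sum>\<^sub>\<infinity>g\<in>A. of_real (pmf p g) * \<eta> g)) \<le> (\<integral>\<^sup>+g. ennreal (cmod (\<eta> g)) \<partial>measure_pmf p)"
proof (cases "(\<lambda>g. of_real (pmf p g) * \<eta> g) summable_on A")
  case False
  then show ?thesis by (simp add: infsum_not_exists)
next
  case True
  then have s: "(\<lambda>g. pmf p g * cmod (\<eta> g)) summable_on A"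
    using summable_on_iff_abs_summable_on_complex[of "\<lambda>g. of_real (pmf p g) * \<eta> g" A]
    by (simp add: norm_mult)
  have "cmod (\<Sum>\<^sub>\<infinity>g\<in>A. of_real (pmf p g) * \<eta> g) \<le> (\<Sum>\<^sub>\<infinity>g\<in>A. pmf p g * cmod (\<eta> g))"
    using norm_infsum_bound[of "\<lambda>g. of_real (pmf p g) * \<eta> g" A] s by (simp add: norm_mult)
  then have "ennreal (cmod (\<Sum>\<^sub>\<infinity>g\<in>A. of_real (pmf p g) * \<eta> g)) \<le> ennreal (\<Sum>\<^sub>\<infinity>g\<in>A. pmf p g * cmod (\<eta> g))"
    by (rule ennreal_leI)
  also have "\<dots> = (SUP F\<in>{F. finite F \<and> F \<subseteq> A}. ennreal (\<Sum>g\<in>F. pmf p g * cmod (\<eta> g)))"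
    using s by (intro infsum_nonneg_is_SUPREMUM_ennreal) auto
  also have "\<dots> \<le> (\<integral>\<^sup>+g. ennreal (cmod (\<eta> g)) \<partial>measure_pmf p)"
  proof (rule SUP_least)
    fix F assume "F \<in> {F. finite F \<and> F \<subseteq> A}"
    then have F: "finite F" by auto
    have "ennreal (\<Sum>g\<in>F. pmf p g * cmod (\<eta> g)) = (\<Sum>g\<in>F. ennreal (pmf p g) * ennreal (cmod (\<eta> g)))"
      by (simp add: ennreal_mult flip: sum_ennreal)
    also have "\<dots> = (\<integral>\<^sup>+g. ennreal (pmf p g) * ennreal (cmod (\<eta> g)) \<partial>count_space F)"
      using F by (simp add: nn_integral_count_space_finite)
    also have "\<dots> = (\<integral>\<^sup>+g. ennreal (pmf p g) * ennreal (cmod (\<eta> g)) * indicator F g \<partial>count_space UNIV)"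
      by (subst nn_integral_count_space_indicator) auto
    also have "\<dots> \<le> (\<integral>\<^sup>+g. ennreal (pmf p g) * ennreal (cmod (\<eta> g)) \<partial>count_space UNIV)"
      by (intro nn_integral_mono) (auto split: split_indicator)
    also have "\<dots> = (\<integral>\<^sup>+g. ennreal (cmod (\<eta> g)) \<partial>measure_pmf p)"
      by (rule nn_integral_measure_pmf[symmetric])
    finally show "ennreal (\<Sum>g\<in>F. pmf p g * cmod (\<eta> g)) \<le> (\<integral>\<^sup>+g. ennreal (cmod (\<eta> g)) \<partial>measure_pmf p)" .
  qed
  finally show ?thesis .
qed

section \<open>Norms and operator norms on l^q\<close>

lemma lq_norm_nonneg: "lq_norm q A \<xi> \<ge> 0" by (simp add: lq_norm_def)

lemma lq_norm_powr:
  assumes "q > 0" shows "lq_norm q A \<xi> powr q = (\<Sum>\<^sub>\<infinity>x\<in>A. cmod (\<xi> x) powr q)"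
  using assms by (simp add: lq_norm_def powr_powr powr_one' infsum_nonneg)

lemma lq_scale:
  assumes "q > 0" "\<xi> \<in> lq_space q A"
  shows "(\<lambda>x. c * \<xi> x) \<in> lq_space q A" "lq_norm q A (\<lambda>x. c * \<xi> x) = cmod c * lq_norm q A \<xi>"
proof -
  have "(\<lambda>x. cmod (c * \<xi> x) powr q) = (\<lambda>x. cmod c powr q * cmod (\<xi> x) powr q)"
    by (simp add: norm_mult powr_mult)
  then show "(\<lambda>x. c * \<xi> x) \<in> lq_space q A" "lq_norm q A (\<lambda>x. c * \<xi> x) = cmod c * lq_norm q A \<xi>"
    using assms by (auto simp: lq_space_def lq_norm_def infsum_cmult_right summable_on_cmult_right
        powr_mult powr_powr powr_one' infsum_nonneg)
qed

lemma lq_opnorm_le: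
  assumes "q > 0" "K \<ge> 0" "\<And>\<xi>. \<xi> \<in> lq_space q A \<Longrightarrow> lq_norm q A (T \<xi>) \<le> K * lq_norm q A \<xi>"
  shows "lq_opnorm q A T \<le> K"
  unfolding lq_opnorm_def
proof (rule cSup_least)
  have "(\<lambda>_. 0) \<in> lq_space q A \<and> lq_norm q A (\<lambda>_. 0) \<le> 1" by (simp add: lq_space_def lq_norm_def)
  then show "{lq_norm q A (T \<xi>) | \<xi>. \<xi> \<in> lq_space q A \<and> lq_norm q A \<xi> \<le> 1} \<noteq> {}" by blast
next
  fix r assume "r \<in> {lq_norm q A (T \<xi>) | \<xi>. \<xi> \<in> lq_space q A \<and> lq_norm q A \<xi> \<le> 1}"
  then obtain \<xi> where \<xi>: "r = lq_norm q A (T \<xi>)" "\<xi> \<in> lq_space q A" "lq_norm q A \<xi> \<le> 1" by auto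
  have "r \<le> K * lq_norm q A \<xi>" using assms(3) \<xi> by simp
  also have "\<dots> \<le> K * 1" using \<xi>(3) assms(2) by (rule mult_left_mono)
  finally show "r \<le> K" by simp
qed

text \<open>The a priori constant \<open>K\<close> makes the defining set bounded, so that its
  supremum is genuine; homogeneity then reduces to a vector of norm 1. For a vector of norm 0 the a
  priori bound itself suffices.\<close>

lemma lq_opnorm_upper:
  assumes q: "q > 0" and bd: "\<And>\<xi>. \<xi> \<in> lq_space q A \<Longrightarrow> lq_norm q A (T \<xi>) \<le> K * lq_norm q A \<xi>" "K \<ge> 0"
    and hom: "\<And>c \<xi>. T (\<lambda>x. c * \<xi> x) = (\<lambda>x. c * T \<xi> x)"
    and img: "\<And>\<xi>. \<xi> \<in> lq_space q A \<Longrightarrow> T \<xi> \<in> lq_space q A"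
    and \<xi>: "\<xi> \<in> lq_space q A"
  shows "lq_norm q A (T \<xi>) \<le> lq_opnorm q A T * lq_norm q A \<xi>"
proof (cases "lq_norm q A \<xi> = 0")
  case True
  then show ?thesis using bd(1)[OF \<xi>] by simp
next
  case False
  define N where "N = lq_norm q A \<xi>"
  have N: "N > 0" using False lq_norm_nonneg[of q A \<xi>] by (simp add: N_def)
  define \<zeta> where "\<zeta> x = complex_of_real (1 / N) * \<xi> x" for x
  have \<zeta>: "\<zeta> \<in> lq_space q A" "lq_norm q A \<zeta> = 1"
    using lq_scale[OF q \<xi>, of "complex_of_real (1 / N)"] N by (simp_all add: \<zeta>_def[abs_def] N_def norm_divide)
  have "bdd_above {lq_norm q A (T \<xi>) | \<xi>. \<xi> \<in> lq_space q A \<and> lq_norm q A \<xi> \<le> 1}"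
  proof (rule bdd_aboveI[of _ K])
    fix r assume "r \<in> {lq_norm q A (T \<xi>) | \<xi>. \<xi> \<in> lq_space q A \<and> lq_norm q A \<xi> \<le> 1}"
    then obtain \<xi> where \<xi>: "r = lq_norm q A (T \<xi>)" "\<xi> \<in> lq_space q A" "lq_norm q A \<xi> \<le> 1" by auto
    have "r \<le> K * lq_norm q A \<xi>" using bd \<xi> by simp
    also have "\<dots> \<le> K * 1" using \<xi>(3) bd(2) by (rule mult_left_mono)
    finally show "r \<le> K" by simp
  qed
  then have "lq_norm q A (T \<zeta>) \<le> lq_opnorm q A T"
    unfolding lq_opnorm_def using \<zeta> by (intro cSup_upper) auto
  moreover have "lq_norm q A (T \<zeta>) = 1 / N * lq_norm q A (T \<xi>)"
    unfolding \<zeta>_def hom using lq_scale(2)[OF q img[OF \<xi>], of "complex_of_real (1 / N)"] N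
    by (simp add: norm_divide)
  ultimately show ?thesis using N by (simp add: N_def[symmetric] field_simps)
qed

text \<open>l^q consists of bounded functions, so the orbit values of such a function are integrable
  against any probability on G.\<close>

lemma lq_bounded:
  assumes "q > 0" "\<xi> \<in> lq_space q A" "x \<in> A"
  shows "cmod (\<xi> x) \<le> lq_norm q A \<xi>"
proof -
  have "cmod (\<xi> x) powr q \<le> (\<Sum>\<^sub>\<infinity>x\<in>A. cmod (\<xi> x) powr q)"
    using finite_sum_le_infsum[of "\<lambda>x. cmod (\<xi> x) powr q" A "{x}"] assms by (simp add: lq_space_def)
  then have "(cmod (\<xi> x) powr q) powr (1 / q) \<le> lq_norm q A \<xi>"
    unfolding lq_norm_def using assms(1) by (intro powr_mono2) auto
  then show ?thesis using assms(1) by (simp add: powr_powr powr_one')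
qed

context coset_space begin

text \<open>Passage from finite sums to the operator: a bound for all finite \<open>B\<close>,
  \<open>X0\<close>, \<open>Y\<close> becomes an l^q bound for anything dominated by the average of
  |\<xi>| under the law \<open>m\<close>.\<close>

lemma lq_bound:
  assumes m: "set_pmf m \<subseteq> carrier G" and q: "q > 0" and K: "K \<ge> 0" and \<xi>: "\<xi> \<in> lq_space q X"
    and \<eta>: "\<And>x. x \<in> X \<Longrightarrow> ennreal (cmod (\<eta> x)) \<le> (\<integral>\<^sup>+g. ennreal (cmod (\<xi> (inv g <# x))) \<partial>measure_pmf m)"
    and fin: "\<And>B X0 Y. finite B \<Longrightarrow> B \<subseteq> set_pmf m \<Longrightarrow> finite X0 \<Longrightarrow> X0 \<subseteq> X \<Longrightarrow> finite Y \<Longrightarrow> Y \<subseteq> X \<Longrightarrow>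
       (\<And>g x. g \<in> B \<Longrightarrow> x \<in> X0 \<Longrightarrow> inv g <# x \<in> Y) \<Longrightarrow>
       (\<Sum>x\<in>X0. (\<Sum>g\<in>B. pmf m g * cmod (\<xi> (inv g <# x))) powr q) \<le> K * (\<Sum>y\<in>Y. cmod (\<xi> y) powr q)"
  shows "\<eta> \<in> lq_space q X" "lq_norm q X \<eta> \<le> K powr (1 / q) * lq_norm q X \<xi>"
proof -
  define N where "N = (\<Sum>\<^sub>\<infinity>x\<in>X. cmod (\<xi> x) powr q)"
  define S where "S x = measure_pmf.expectation m (\<lambda>g. cmod (\<xi> (inv g <# x)))" for x
  have int: "integrable (measure_pmf m) (\<lambda>g. cmod (\<xi> (inv g <# x)))" if "x \<in> X" for x
  proof (rule integrable_pmf_bounded)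
    fix g assume "g \<in> set_pmf m"
    then have "inv g <# x \<in> X" using m that act_X by auto
    then show "\<bar>cmod (\<xi> (inv g <# x))\<bar> \<le> lq_norm q X \<xi>" using lq_bounded[OF q \<xi>] by simp
  qed
  have S: "((\<lambda>g. pmf m g * cmod (\<xi> (inv g <# x))) has_sum S x) (set_pmf m)" if "x \<in> X" for x
    unfolding S_def using has_sum_expectation_set_pmf[OF int[OF that]] by simp
  have \<eta>S: "cmod (\<eta> x) \<le> S x" if "x \<in> X" for x
  proof -
    have "ennreal (cmod (\<eta> x)) \<le> ennreal (S x)"
      using \<eta>[OF that] int[OF that] unfolding S_def by (subst (asm) nn_integral_eq_integral) auto
    moreover have "S x \<ge> 0" unfolding S_def by simp
    ultimately show ?thesis by simp
  qed
  \<comment> \<open>With \<open>X0\<close> fixed only finitely many powers occur, so the limit over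
    finite \<open>B\<close> passes through them; \<open>X0\<close> exhausts \<open>X\<close>
    afterwards.\<close>
  have bound: "(\<Sum>x\<in>X0. cmod (\<eta> x) powr q) \<le> K * N" if X0: "finite X0" "X0 \<subseteq> X" for X0
  proof -
    have "(\<Sum>x\<in>X0. cmod (\<eta> x) powr q) \<le> (\<Sum>x\<in>X0. S x powr q)"
      using \<eta>S X0 q by (intro sum_mono powr_mono2) auto
    also have "\<dots> \<le> K * N"
    proof (rule tendsto_upperbound)
      show "((\<lambda>B. \<Sum>x\<in>X0. (\<Sum>g\<in>B. pmf m g * cmod (\<xi> (inv g <# x))) powr q) \<longlongrightarrow> (\<Sum>x\<in>X0. S x powr q))
          (finite_subsets_at_top (set_pmf m))"
        using S X0 q unfolding has_sum_def
        by (intro tendsto_sum tendsto_powr2 tendsto_const) (auto intro!: always_eventually sum_nonneg)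
      show "\<forall>\<^sub>F B in finite_subsets_at_top (set_pmf m).
          (\<Sum>x\<in>X0. (\<Sum>g\<in>B. pmf m g * cmod (\<xi> (inv g <# x))) powr q) \<le> K * N"
      proof (rule eventually_finite_subsets_at_top_weakI)
        fix B assume B: "finite B" "B \<subseteq> set_pmf m"
        have BG: "B \<subseteq> carrier G" using B m by blast
        define Y where "Y = (\<lambda>(g, x). inv g <# x) ` (B \<times> X0)"
        have Y: "finite Y" "Y \<subseteq> X" using B X0 BG by (auto simp: Y_def subset_iff intro!: act_X)
        have "(\<Sum>x\<in>X0. (\<Sum>g\<in>B. pmf m g * cmod (\<xi> (inv g <# x))) powr q) \<le> K * (\<Sum>y\<in>Y. cmod (\<xi> y) powr q)"
          using B X0 Y by (intro fin) (auto simp: Y_def)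
        also have "\<dots> \<le> K * N" unfolding N_def using K Y \<xi>
          by (intro mult_left_mono finite_sum_le_infsum) (auto simp: lq_space_def)
        finally show "(\<Sum>x\<in>X0. (\<Sum>g\<in>B. pmf m g * cmod (\<xi> (inv g <# x))) powr q) \<le> K * N" .
      qed
    qed simp
    finally show ?thesis .
  qed
  have s: "(\<lambda>x. cmod (\<eta> x) powr q) summable_on X"
    using bound by (intro nonneg_bdd_above_summable_on bdd_aboveI[of _ "K * N"]) auto
  then show "\<eta> \<in> lq_space q X" by (simp add: lq_space_def)
  have "(\<Sum>\<^sub>\<infinity>x\<in>X. cmod (\<eta> x) powr q) \<le> K * N"
    using bound s by (intro infsum_le_finite_sums) auto
  then have "lq_norm q X \<eta> \<le> (K * N) powr (1 / q)"
    unfolding lq_norm_def using q by (intro powr_mono2) (auto intro!: infsum_nonneg)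
  then show "lq_norm q X \<eta> \<le> K powr (1 / q) * lq_norm q X \<xi>"
    using K by (simp add: lq_norm_def N_def powr_mult infsum_nonneg)
qed

end

section \<open>The walk and the powers of its averaging operator\<close>

locale coset_random_walk = coset_space +
  fixes \<mu> :: "'a pmf"
  assumes support: "set_pmf \<mu> \<subseteq> carrier G"
begin

abbreviation T where "T \<equiv> quasi_regular_op G \<mu>"
abbreviation m where "m \<equiv> conv_power G \<mu>"
abbreviation \<nu> where "\<nu> \<equiv> coset_walk G H \<mu>"

lemma support_m: "set_pmf (m n) \<subseteq> carrier G"
  using support by (induction n) (auto simp: convolve_pmf_def)

lemma support_\<nu>: "set_pmf (\<nu> n) \<subseteq> X"
  using support_m coset_in_X by (auto simp: coset_walk_def)

lemma inv_act_mult: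
  "g \<in> carrier G \<Longrightarrow> h \<in> carrier G \<Longrightarrow> x \<in> X \<Longrightarrow> inv h <# (inv g <# x) = inv (g \<otimes> h) <# x"
  by (simp add: act_act inv_mult_group)

text \<open>T^n averages over the n-th convolution power. For a general \<xi> only this domination
  is recorded, with values in [0, \<infinity>], so that summability of the iterated series need not
  be discussed.\<close>

lemma T_power_le:
  "x \<in> X \<Longrightarrow> ennreal (cmod ((T ^^ n) \<xi> x)) \<le> (\<integral>\<^sup>+g. ennreal (cmod (\<xi> (inv g <# x))) \<partial>measure_pmf (m n))"
proof (induction n arbitrary: x)
  case 0
  then show ?case by (simp add: act_one)
next
  case (Suc n)
  have "ennreal (cmod ((T ^^ Suc n) \<xi> x)) \<le> (\<integral>\<^sup>+g. ennreal (cmod ((T ^^ n) \<xi> (inv g <# x))) \<partial>measure_pmf \<mu>)"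
    unfolding funpow.simps o_apply quasi_regular_op_def quasi_regular_def by (rule norm_infsum_pmf_le)
  also have "\<dots> \<le> (\<integral>\<^sup>+g. (\<integral>\<^sup>+h. ennreal (cmod (\<xi> (inv (g \<otimes> h) <# x))) \<partial>measure_pmf (m n)) \<partial>measure_pmf \<mu>)"
  proof (rule nn_integral_mono_AE, unfold AE_measure_pmf_iff, rule ballI)
    fix g assume "g \<in> set_pmf \<mu>"
    then have g: "g \<in> carrier G" using support by auto
    have "ennreal (cmod ((T ^^ n) \<xi> (inv g <# x)))
        \<le> (\<integral>\<^sup>+h. ennreal (cmod (\<xi> (inv h <# (inv g <# x)))) \<partial>measure_pmf (m n))"
      using Suc g act_X by simp
    also have "\<dots> = (\<integral>\<^sup>+h. ennreal (cmod (\<xi> (inv (g \<otimes> h) <# x))) \<partial>measure_pmf (m n))"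
      using inv_act_mult[OF g _ Suc.prems] support_m[of n]
      by (intro nn_integral_cong_AE) (auto simp: AE_measure_pmf_iff subset_iff)
    finally show "ennreal (cmod ((T ^^ n) \<xi> (inv g <# x)))
      \<le> (\<integral>\<^sup>+h. ennreal (cmod (\<xi> (inv (g \<otimes> h) <# x))) \<partial>measure_pmf (m n))" .
  qed
  also have "\<dots> = (\<integral>\<^sup>+g. ennreal (cmod (\<xi> (inv g <# x))) \<partial>measure_pmf (m (Suc n)))"
    by (simp add: convolve_pmf_def nn_integral_pair_pmf')
  finally show ?case .
qed

lemma T_power_hom: "(T ^^ n) (\<lambda>x. c * \<xi> x) = (\<lambda>x. c * (T ^^ n) \<xi> x)"
proof (induction n)
  case (Suc n)
  have "T (\<lambda>x. c * \<zeta> x) = (\<lambda>x. c * T \<zeta> x)" for \<zeta> :: "'a set \<Rightarrow> complex"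
    unfolding quasi_regular_op_def quasi_regular_def
    by (subst infsum_cmult_right'[symmetric]) (simp add: algebra_simps)
  then show ?case by (simp add: Suc)
qed simp

text \<open>The a priori bound that turns \<open>lq_opnorm\<close> into a true operator norm; the
  factor 1 is written out to fit the shape K * norm expected by
  \<open>lq_opnorm_upper\<close>.\<close>

lemma T_power_contraction:
  assumes q: "q > 1" and \<xi>: "\<xi> \<in> lq_space q X"
  shows "(T ^^ n) \<xi> \<in> lq_space q X" "lq_norm q X ((T ^^ n) \<xi>) \<le> 1 * lq_norm q X \<xi>"
proof -
  have fin: "(\<Sum>x\<in>X0. (\<Sum>g\<in>B. pmf (m n) g * cmod (\<xi> (inv g <# x))) powr q) \<le> 1 * (\<Sum>y\<in>Y. cmod (\<xi> y) powr q)"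
    if B: "finite B" "B \<subseteq> set_pmf (m n)" and X0: "finite X0" "X0 \<subseteq> X" and Y: "finite Y" "Y \<subseteq> X"
      and cover: "\<And>g x. g \<in> B \<Longrightarrow> x \<in> X0 \<Longrightarrow> inv g <# x \<in> Y" for B X0 Y
  proof -
    have "sum (pmf (m n)) B \<le> 1"
      using B by (simp add: measure_measure_pmf_finite[symmetric])
    moreover have "B \<subseteq> carrier G" using B support_m by blast
    ultimately show ?thesis
      using sum_contraction[of "q - 1" B "pmf (m n)" X0 Y "\<lambda>x. cmod (\<xi> x)"] q B X0 Y cover
      by (auto simp: pmf_positive subset_iff)
  qed
  show "(T ^^ n) \<xi> \<in> lq_space q X"
    using q \<xi> by (intro lq_bound(1)[OF support_m _ _ \<xi> T_power_le fin]) auto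
  show "lq_norm q X ((T ^^ n) \<xi>) \<le> 1 * lq_norm q X \<xi>"
  proof -
    have "lq_norm q X ((T ^^ n) \<xi>) \<le> 1 powr (1 / q) * lq_norm q X \<xi>"
      using q \<xi> by (intro lq_bound(2)[OF support_m _ _ \<xi> T_power_le fin]) auto
    then show ?thesis by simp
  qed
qed

lemma lq_norm_T_power_le:
  assumes "q > 1" "\<xi> \<in> lq_space q X"
  shows "lq_norm q X ((T ^^ n) \<xi>) \<le> lq_opnorm q X (T ^^ n) * lq_norm q X \<xi>"
  using assms T_power_contraction T_power_hom
  by (intro lq_opnorm_upper[where K = 1]) auto

lemma opnorm_nonneg:
  assumes "q > 1"
  shows "lq_opnorm q X (T ^^ n) \<ge> 0"
proof -
  define \<delta> where "\<delta> x = (if x = H then 1 else 0 :: complex)" for x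
  have HX: "H \<in> X" using coset_in_X[of \<one>] lcos_mult_one[OF H_carrier] by simp
  have "((\<lambda>x. cmod (\<delta> x) powr q) has_sum 1) X"
    using HX by (intro has_sum_finite_neutralI[of "{H}"]) (auto simp: \<delta>_def)
  then have "\<delta> \<in> lq_space q X" "lq_norm q X \<delta> = 1"
    by (auto simp: lq_space_def lq_norm_def summable_on_def infsumI)
  then show ?thesis using lq_norm_T_power_le[OF assms, of \<delta> n] lq_norm_nonneg[of q X "(T ^^ n) \<delta>"] by simp
qed

lemma opnorm_submult:
  assumes q: "q > 1"
  shows "lq_opnorm q X (T ^^ (k + n)) \<le> lq_opnorm q X (T ^^ k) * lq_opnorm q X (T ^^ n)"
proof (rule lq_opnorm_le)
  fix \<xi> assume \<xi>: "\<xi> \<in> lq_space q X"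
  have "lq_norm q X ((T ^^ (k + n)) \<xi>) \<le> lq_opnorm q X (T ^^ k) * lq_norm q X ((T ^^ n) \<xi>)"
    unfolding funpow_add o_apply using q \<xi> by (intro lq_norm_T_power_le T_power_contraction)
  also have "\<dots> \<le> lq_opnorm q X (T ^^ k) * (lq_opnorm q X (T ^^ n) * lq_norm q X \<xi>)"
    using q \<xi> by (intro mult_left_mono lq_norm_T_power_le opnorm_nonneg)
  finally show "lq_norm q X ((T ^^ (k + n)) \<xi>) \<le> lq_opnorm q X (T ^^ k) * lq_opnorm q X (T ^^ n) * lq_norm q X \<xi>"
    by simp
qed (use q opnorm_nonneg in auto)

text \<open>\<open>conv_power\<close> adds each new factor on the left, so conditioning on it
  translates the previous law on cosets; the result is one application of T.\<close>

lemma pmf_\<nu>_Suc: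
  assumes x: "x \<in> X"
  shows "pmf (\<nu> (Suc n)) x = measure_pmf.expectation \<mu> (\<lambda>g. pmf (\<nu> n) (inv g <# x))"
proof -
  have "\<nu> (Suc n) = bind_pmf \<mu> (\<lambda>g. bind_pmf (m n) (\<lambda>h. return_pmf ((g \<otimes> h) <# H)))"
    by (simp add: coset_walk_def convolve_pmf_def pair_pmf_def map_bind_pmf map_pmf_comp)
  also have "\<dots> = bind_pmf \<mu> (\<lambda>g. bind_pmf (m n) (\<lambda>h. return_pmf (g <# (h <# H))))"
    using support support_m[of n] H_carrier by (intro bind_pmf_cong refl) (auto simp: lcos_m_assoc subset_iff)
  also have "\<dots> = bind_pmf \<mu> (\<lambda>g. map_pmf (\<lambda>y. g <# y) (\<nu> n))"
    by (simp add: coset_walk_def map_pmf_comp) (simp add: map_pmf_def)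
  finally have eq: "\<nu> (Suc n) = bind_pmf \<mu> (\<lambda>g. map_pmf (\<lambda>y. g <# y) (\<nu> n))" .
  have "pmf (map_pmf (\<lambda>y. g <# y) (\<nu> n)) x = pmf (\<nu> n) (inv g <# x)" if "g \<in> set_pmf \<mu>" for g
  proof -
    have g: "g \<in> carrier G" using that support by auto
    have "(\<lambda>y. g <# y) -` {x} \<inter> set_pmf (\<nu> n) = {inv g <# x} \<inter> set_pmf (\<nu> n)"
      using act_inv1[OF g] act_inv2[OF g x] support_\<nu>[of n] by auto
    then show ?thesis
      by (metis measure_Int_set_pmf measure_pmf_single pmf_map)
  qed
  then show ?thesis unfolding eq pmf_bind
    by (intro integral_cong_AE) (auto simp: AE_measure_pmf_iff)
qed

lemma T_power_delta:
  assumes "x \<in> X"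
  shows "(T ^^ n) (\<lambda>x. if x = H then 1 else 0) x = complex_of_real (pmf (\<nu> n) x)"
  using assms
proof (induction n arbitrary: x)
  case 0
  then show ?case using H_carrier by (simp add: coset_walk_def lcos_mult_one pmf_return)
next
  case (Suc n)
  have "((\<lambda>g. pmf \<mu> g * pmf (\<nu> n) (inv g <# x)) has_sum pmf (\<nu> (Suc n)) x) (carrier G)"
    unfolding pmf_\<nu>_Suc[OF Suc.prems] using support
    by (intro has_sum_expectation_set_pmf integrable_pmf_bounded[where c = 1]) (auto simp: pmf_le_1)
  then have "((\<lambda>g. complex_of_real (pmf \<mu> g) * complex_of_real (pmf (\<nu> n) (inv g <# x)))
      has_sum complex_of_real (pmf (\<nu> (Suc n)) x)) (carrier G)"
    unfolding of_real_mult[symmetric] by (rule has_sum_of_real)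
  then have "((\<lambda>g. complex_of_real (pmf \<mu> g) * (T ^^ n) (\<lambda>x. if x = H then 1 else 0) (inv g <# x))
      has_sum complex_of_real (pmf (\<nu> (Suc n)) x)) (carrier G)"
    using Suc by (subst (asm) has_sum_cong) (auto simp: act_X)
  then show ?case unfolding funpow.simps o_apply
    by (subst quasi_regular_op_def) (simp add: quasi_regular_def infsumI)
qed

lemma renyi_sum_le_opnorm:
  assumes q: "q > 1"
  shows "(\<Sum>\<^sub>\<infinity>x. pmf (\<nu> n) x powr q) \<le> lq_opnorm q X (T ^^ n) powr q"
proof -
  define \<delta> where "\<delta> x = (if x = H then 1 else 0 :: complex)" for x
  have HX: "H \<in> X" using coset_in_X[of \<one>] lcos_mult_one[OF H_carrier] by simp
  have "((\<lambda>x. cmod (\<delta> x) powr q) has_sum 1) X"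
    using HX by (intro has_sum_finite_neutralI[of "{H}"]) (auto simp: \<delta>_def)
  then have \<delta>: "\<delta> \<in> lq_space q X" "lq_norm q X \<delta> = 1"
    by (auto simp: lq_space_def lq_norm_def summable_on_def infsumI)
  have "(\<Sum>\<^sub>\<infinity>x. pmf (\<nu> n) x powr q) = (\<Sum>\<^sub>\<infinity>x\<in>X. pmf (\<nu> n) x powr q)"
    using support_\<nu>[of n] by (intro infsum_cong_neutral) (auto simp: set_pmf_iff subset_iff)
  also have "\<dots> = lq_norm q X ((T ^^ n) \<delta>) powr q"
    using q T_power_delta[of _ n] by (auto simp: lq_norm_powr \<delta>_def[abs_def] intro!: infsum_cong)
  also have "\<dots> \<le> lq_opnorm q X (T ^^ n) powr q"
    using lq_norm_T_power_le[OF q \<delta>(1), of n] \<delta>(2) q lq_norm_nonneg by (intro powr_mono2) auto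
  finally show ?thesis .
qed

lemma opnorm_rapid_decay:
  assumes rd: "pair_rapid_decay G H l C s" and e: "0 < e" "e \<le> 1"
    and int: "integrable (measure_pmf (m n)) (\<lambda>g. (pmf (\<nu> n) (g <# H) * (1 + real (l g)) powr (2 * s)) powr e)"
      (is "integrable _ ?W")
  shows "lq_opnorm (1 + e) X (T ^^ n) powr (1 + e) \<le> C powr (2 * e) * measure_pmf.expectation (m n) ?W"
proof -
  define M where "M = measure_pmf.expectation (m n) ?W"
  have M0: "M \<ge> 0" unfolding M_def by simp
  have hs: "((\<lambda>g. pmf (m n) g * ?W g) has_sum M) (set_pmf (m n))"
    unfolding M_def using int by (rule has_sum_expectation_set_pmf) simp
  define K where "K = C powr (2 * e) * M"
  have K0: "K \<ge> 0" using M0 by (simp add: K_def)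
  have fin: "(\<Sum>x\<in>X0. (\<Sum>g\<in>B. pmf (m n) g * cmod (\<xi> (inv g <# x))) powr (1 + e))
       \<le> K * (\<Sum>y\<in>Y. cmod (\<xi> y) powr (1 + e))"
    if B: "finite B" "B \<subseteq> set_pmf (m n)" and X0: "finite X0" "X0 \<subseteq> X" and Y: "finite Y" "Y \<subseteq> X"
      and cover: "\<And>g x. g \<in> B \<Longrightarrow> x \<in> X0 \<Longrightarrow> inv g <# x \<in> Y" for B X0 Y and \<xi> :: "'a set \<Rightarrow> complex"
  proof -
    have BG: "B \<subseteq> carrier G" using B support_m by blast
    have pos: "\<And>g. g \<in> B \<Longrightarrow> pmf (m n) g > 0" using B by (auto simp: pmf_positive)
    \<comment> \<open>A finite \<open>B\<close> sees only part of the mass of a coset, hence an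
      inequality.\<close>
    have \<nu>B: "(\<Sum>h | h \<in> B \<and> h <# H = g <# H. pmf (m n) h) \<le> pmf (\<nu> n) (g <# H)" for g
    proof -
      have "(\<Sum>h | h \<in> B \<and> h <# H = g <# H. pmf (m n) h) = measure_pmf.prob (m n) {h \<in> B. h <# H = g <# H}"
        using B by (simp add: measure_measure_pmf_finite)
      also have "\<dots> \<le> measure_pmf.prob (m n) ((\<lambda>h. h <# H) -` {g <# H})"
        by (intro measure_pmf.finite_measure_mono) auto
      also have "\<dots> = pmf (\<nu> n) (g <# H)" by (simp add: coset_walk_def pmf_map)
      finally show ?thesis .
    qed
    have "(\<Sum>x\<in>X0. (\<Sum>g\<in>B. pmf (m n) g * cmod (\<xi> (inv g <# x))) powr (1 + e))
      \<le> C powr (2 * e) * (\<Sum>g\<in>B. pmf (m n) g * ?W g) * (\<Sum>y\<in>Y. cmod (\<xi> y) powr (1 + e))"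
      using rapid_decay_interpolation[OF rd e B(1) BG pos \<nu>B X0 Y cover, where \<Phi> = "\<lambda>y. cmod (\<xi> y)"] by simp
    also have "\<dots> \<le> C powr (2 * e) * M * (\<Sum>y\<in>Y. cmod (\<xi> y) powr (1 + e))"
      using B hs by (intro mult_right_mono mult_left_mono finite_sum_le_has_sum[OF hs] sum_nonneg) auto
    finally show ?thesis by (simp add: K_def)
  qed
  have "lq_opnorm (1 + e) X (T ^^ n) \<le> K powr (1 / (1 + e))"
  proof (rule lq_opnorm_le)
    fix \<xi> assume \<xi>: "\<xi> \<in> lq_space (1 + e) X"
    show "lq_norm (1 + e) X ((T ^^ n) \<xi>) \<le> K powr (1 / (1 + e)) * lq_norm (1 + e) X \<xi>"
      using e K0 by (intro lq_bound(2)[OF support_m _ _ \<xi> T_power_le fin]) auto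
  qed (use e in auto)
  then have "lq_opnorm (1 + e) X (T ^^ n) powr (1 + e) \<le> (K powr (1 / (1 + e))) powr (1 + e)"
    using e opnorm_nonneg[of "1 + e" n] by (intro powr_mono2) auto
  also have "\<dots> = K" using e K0 by (simp add: powr_powr powr_one')
  finally show ?thesis by (simp add: K_def M_def)
qed

end

section \<open>Entropy of discrete distributions\<close>

lemma neg_pmf_ln_nonneg: "0 \<le> - (pmf p x * ln (pmf p x))"
proof (cases "pmf p x = 0")
  case False
  then have "ln (pmf p x) \<le> 0" using pmf_le_1[of p x] pmf_nonneg[of p x] by simp
  then show ?thesis by (simp add: mult_nonneg_nonpos)
qed simp

text \<open>Moves from the extended-real series to the integral of the information function, the
  form in which entropy is handled from here on.\<close>

lemma shannon_entropy_finite_integrable: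
  assumes "shannon_entropy p < \<infinity>"
  shows "integrable (measure_pmf p) (\<lambda>x. - ln (pmf p x))"
proof -
  let ?F = "\<lambda>x. - (pmf p x * ln (pmf p x))"
  define E where "E = (\<Sum>\<^sub>\<infinity>x. ennreal (?F x))"
  have fin: "E < \<infinity>"
  proof (rule ccontr)
    assume "\<not> E < \<infinity>"
    then have "E = \<infinity>" by (simp add: less_top[symmetric])
    then show False using assms unfolding shannon_entropy_def E_def[symmetric] by simp
  qed
  have "sum ?F A \<le> enn2real E" if "finite A" for A
  proof -
    have "ennreal (sum ?F A) = (\<Sum>x\<in>A. ennreal (?F x))"
      using neg_pmf_ln_nonneg by (intro sum_ennreal[symmetric]) auto
    also have "\<dots> \<le> (SUP A\<in>{A. finite A \<and> A \<subseteq> UNIV}. \<Sum>x\<in>A. ennreal (?F x))"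
      using that by (intro SUP_upper) auto
    also have "\<dots> = E" unfolding E_def by (intro nonneg_infsum_complete[symmetric]) auto
    finally have "enn2real (ennreal (sum ?F A)) \<le> enn2real E" using fin by (intro enn2real_mono) auto
    moreover have "0 \<le> sum ?F A" by (intro sum_nonneg neg_pmf_ln_nonneg)
    ultimately show ?thesis by (simp only: enn2real_ennreal)
  qed
  then have "?F summable_on UNIV"
    using neg_pmf_ln_nonneg by (intro nonneg_bdd_above_summable_on bdd_aboveI[of _ "enn2real E"]) auto
  then have "Infinite_Sum.abs_summable_on ?F UNIV"
    using neg_pmf_ln_nonneg by (subst summable_on_iff_abs_summable_on_real[symmetric])
  then have "integrable (count_space UNIV) (\<lambda>x. pmf p x *\<^sub>R - ln (pmf p x))"
    unfolding abs_summable_equivalent by (simp add: Infinite_Set_Sum.abs_summable_on_def)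
  then show ?thesis unfolding measure_pmf_eq_density by (subst integrable_density) auto
qed

lemma shannon_entropy_eq_expectation:
  assumes "integrable (measure_pmf p) (\<lambda>x. - ln (pmf p x))"
  shows "shannon_entropy p = ereal (measure_pmf.expectation p (\<lambda>x. - ln (pmf p x)))"
proof -
  let ?F = "\<lambda>x. - (pmf p x * ln (pmf p x))"
  have hs: "(?F has_sum measure_pmf.expectation p (\<lambda>x. - ln (pmf p x))) UNIV"
    using has_sum_expectation_pmf[OF assms] by simp
  then have s: "?F summable_on UNIV" by (auto simp: summable_on_def)
  have "(\<Sum>\<^sub>\<infinity>x. ennreal (?F x)) = (SUP A\<in>{A. finite A \<and> A \<subseteq> UNIV}. \<Sum>x\<in>A. ennreal (?F x))"
    by (intro nonneg_infsum_complete) auto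
  also have "\<dots> = (SUP A\<in>{A. finite A \<and> A \<subseteq> UNIV}. ennreal (sum ?F A))"
    using neg_pmf_ln_nonneg by (intro SUP_cong refl sum_ennreal) auto
  also have "\<dots> = ennreal (infsum ?F UNIV)"
    using s neg_pmf_ln_nonneg by (intro infsum_nonneg_is_SUPREMUM_ennreal[symmetric]) auto
  also have "infsum ?F UNIV = measure_pmf.expectation p (\<lambda>x. - ln (pmf p x))" using hs by (rule infsumI)
  finally show ?thesis unfolding shannon_entropy_def
    using has_sum_nonneg[OF hs neg_pmf_ln_nonneg] by (simp only: enn2ereal_ennreal)
qed

text \<open>The fibre through a point has at least the mass of the point, so the information of
  \<open>f x\<close> is at most that of \<open>x\<close>, pointwise on the support.\<close>

lemma entropy_map_pmf:
  assumes int: "integrable (measure_pmf p) (\<lambda>x. - ln (pmf p x))"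
  shows "integrable (measure_pmf (map_pmf f p)) (\<lambda>x. - ln (pmf (map_pmf f p) x))"
    and "measure_pmf.expectation (map_pmf f p) (\<lambda>x. - ln (pmf (map_pmf f p) x))
           \<le> measure_pmf.expectation p (\<lambda>x. - ln (pmf p x))"
proof -
  have le: "0 \<le> - ln (pmf (map_pmf f p) (f x))" "- ln (pmf (map_pmf f p) (f x)) \<le> - ln (pmf p x)"
    if "x \<in> set_pmf p" for x
  proof -
    have pos: "pmf p x > 0" using that by (simp add: pmf_positive)
    have "measure_pmf.prob p {x} \<le> measure_pmf.prob p (f -` {f x})"
      by (intro measure_pmf.finite_measure_mono) auto
    then have "pmf p x \<le> pmf (map_pmf f p) (f x)" by (simp add: pmf_map measure_pmf_single)
    then show "0 \<le> - ln (pmf (map_pmf f p) (f x))" "- ln (pmf (map_pmf f p) (f x)) \<le> - ln (pmf p x)"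
      using pos pmf_le_1[of "map_pmf f p" "f x"] by auto
  qed
  have i: "integrable (measure_pmf p) (\<lambda>x. - ln (pmf (map_pmf f p) (f x)))"
  proof (rule Bochner_Integration.integrable_bound[OF int])
    show "AE x in measure_pmf p. norm (- ln (pmf (map_pmf f p) (f x))) \<le> norm (- ln (pmf p x))"
      unfolding AE_measure_pmf_iff real_norm_def
    proof
      fix x assume "x \<in> set_pmf p"
      from le[OF this] show "\<bar>- ln (pmf (map_pmf f p) (f x))\<bar> \<le> \<bar>- ln (pmf p x)\<bar>" by linarith
    qed
  qed simp
  then show "integrable (measure_pmf (map_pmf f p)) (\<lambda>x. - ln (pmf (map_pmf f p) x))"
    by (subst integrable_map_pmf_eq)
  show "measure_pmf.expectation (map_pmf f p) (\<lambda>x. - ln (pmf (map_pmf f p) x))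
           \<le> measure_pmf.expectation p (\<lambda>x. - ln (pmf p x))"
    unfolding integral_map_pmf using i int le by (intro integral_mono_AE) (auto simp: AE_measure_pmf_iff)
qed

lemma entropy_pair_pmf:
  assumes p: "integrable (measure_pmf p) (\<lambda>x. - ln (pmf p x))"
    and q: "integrable (measure_pmf q) (\<lambda>x. - ln (pmf q x))"
  shows "integrable (measure_pmf (pair_pmf p q)) (\<lambda>x. - ln (pmf (pair_pmf p q) x))"
    and "measure_pmf.expectation (pair_pmf p q) (\<lambda>x. - ln (pmf (pair_pmf p q) x))
      = measure_pmf.expectation p (\<lambda>x. - ln (pmf p x)) + measure_pmf.expectation q (\<lambda>x. - ln (pmf q x))"
proof -
  have AE: "AE x in measure_pmf (pair_pmf p q). - ln (pmf (pair_pmf p q) x) = - ln (pmf p (fst x)) + - ln (pmf q (snd x))"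
    by (auto simp: AE_measure_pmf_iff pmf_pair ln_mult set_pmf_iff)
  have p': "integrable (measure_pmf (pair_pmf p q)) (\<lambda>x. - ln (pmf p (fst x)))"
    using p integrable_map_pmf_eq[of fst "pair_pmf p q" "\<lambda>x. - ln (pmf p x)"] by (simp add: map_fst_pair_pmf)
  have q': "integrable (measure_pmf (pair_pmf p q)) (\<lambda>x. - ln (pmf q (snd x)))"
    using q integrable_map_pmf_eq[of snd "pair_pmf p q" "\<lambda>x. - ln (pmf q x)"] by (simp add: map_snd_pair_pmf)
  show "integrable (measure_pmf (pair_pmf p q)) (\<lambda>x. - ln (pmf (pair_pmf p q) x))"
    by (rule integrable_cong_AE[THEN iffD2, OF _ _ AE Bochner_Integration.integrable_add[OF p' q']]) simp_all
  have "measure_pmf.expectation (pair_pmf p q) (\<lambda>x. - ln (pmf (pair_pmf p q) x))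
      = measure_pmf.expectation (pair_pmf p q) (\<lambda>x. - ln (pmf p (fst x)) + - ln (pmf q (snd x)))"
    using AE by (intro integral_cong_AE) auto
  also have "\<dots> = measure_pmf.expectation (pair_pmf p q) (\<lambda>x. - ln (pmf p (fst x)))
      + measure_pmf.expectation (pair_pmf p q) (\<lambda>x. - ln (pmf q (snd x)))"
    using p' q' by (rule Bochner_Integration.integral_add)
  also have "measure_pmf.expectation (pair_pmf p q) (\<lambda>x. - ln (pmf p (fst x))) = measure_pmf.expectation p (\<lambda>x. - ln (pmf p x))"
    by (rule expectation_pair_pmf_fst)
  also have "measure_pmf.expectation (pair_pmf p q) (\<lambda>x. - ln (pmf q (snd x))) = measure_pmf.expectation q (\<lambda>x. - ln (pmf q x))"
    by (rule expectation_pair_pmf_snd)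
  finally show "measure_pmf.expectation (pair_pmf p q) (\<lambda>x. - ln (pmf (pair_pmf p q) x))
      = measure_pmf.expectation p (\<lambda>x. - ln (pmf p x)) + measure_pmf.expectation q (\<lambda>x. - ln (pmf q x))" .
qed

text \<open>One factor \<open>pmf p x\<close> is absorbed into the measure, so the Renyi sum becomes
  the moment E[p^e]. Its positivity is what allows logarithms later.\<close>

lemma renyi_sum_expectation:
  assumes "e > 0"
  shows "integrable (measure_pmf p) (\<lambda>x. pmf p x powr e)"
    and "(\<Sum>\<^sub>\<infinity>x. pmf p x powr (1 + e)) = measure_pmf.expectation p (\<lambda>x. pmf p x powr e)"
    and "(\<Sum>\<^sub>\<infinity>x. pmf p x powr (1 + e)) > 0"
proof -
  show i: "integrable (measure_pmf p) (\<lambda>x. pmf p x powr e)"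
    using assms by (intro integrable_pmf_bounded[where c = 1]) (auto intro!: powr_le1 pmf_le_1)
  have eq: "pmf p x powr (1 + e) = pmf p x * pmf p x powr e" for x by (simp add: powr_add powr_one')
  have hs: "((\<lambda>x. pmf p x powr (1 + e)) has_sum measure_pmf.expectation p (\<lambda>x. pmf p x powr e)) UNIV"
    unfolding eq using has_sum_expectation_pmf[OF i] .
  then show "(\<Sum>\<^sub>\<infinity>x. pmf p x powr (1 + e)) = measure_pmf.expectation p (\<lambda>x. pmf p x powr e)" by (rule infsumI)
  obtain x where "x \<in> set_pmf p" using set_pmf_not_empty[of p] by blast
  then have "0 < pmf p x powr (1 + e)" by (simp add: set_pmf_iff)
  also have "\<dots> \<le> (\<Sum>\<^sub>\<infinity>x. pmf p x powr (1 + e))"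
    using finite_sum_le_has_sum[OF hs, of "{x}"] infsumI[OF hs] by simp
  finally show "(\<Sum>\<^sub>\<infinity>x. pmf p x powr (1 + e)) > 0" .
qed

text \<open>From the tangent line of \<open>ln\<close> at \<open>M\<close>.\<close>

lemma expectation_ln_le:
  fixes f :: "'x \<Rightarrow> real"
  assumes i: "integrable (measure_pmf p) (\<lambda>x. ln (f x))" "integrable (measure_pmf p) f"
    and pos: "\<And>x. x \<in> set_pmf p \<Longrightarrow> f x > 0" and M: "measure_pmf.expectation p f \<le> M" "M > 0"
  shows "measure_pmf.expectation p (\<lambda>x. ln (f x)) \<le> ln M"
proof -
  have "measure_pmf.expectation p (\<lambda>x. ln (f x)) \<le> measure_pmf.expectation p (\<lambda>x. f x / M + (ln M - 1))"
  proof (rule integral_mono_AE)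
    show "integrable (measure_pmf p) (\<lambda>x. f x / M + (ln M - 1))" using i(2) by simp
    show "AE x in measure_pmf p. ln (f x) \<le> f x / M + (ln M - 1)" unfolding AE_measure_pmf_iff
    proof
      fix x assume x: "x \<in> set_pmf p"
      have "ln (f x / M) \<le> f x / M - 1" using pos[OF x] M by (intro ln_le_minus_one) auto
      then show "ln (f x) \<le> f x / M + (ln M - 1)" using pos[OF x] M by (simp add: ln_div)
    qed
  qed (use i in simp)
  also have "\<dots> = measure_pmf.expectation p f / M + (ln M - 1)" using i(2) by simp
  also have "\<dots> \<le> 1 + (ln M - 1)" using M by (intro add_right_mono) simp
  finally show ?thesis by simp
qed

text \<open>Jensen for \<open>ln\<close> applied to p^e; division by -e gives that the Renyi entropy
  of order 1 + e is at most the Shannon entropy.\<close>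

lemma renyi_le_shannon:
  assumes int: "integrable (measure_pmf p) (\<lambda>x. - ln (pmf p x))" and e: "e > 0"
  shows "- e * measure_pmf.expectation p (\<lambda>x. - ln (pmf p x)) \<le> ln (\<Sum>\<^sub>\<infinity>x. pmf p x powr (1 + e))"
proof -
  have eq: "(\<lambda>x. ln (pmf p x powr e)) = (\<lambda>x. (- e) * - ln (pmf p x))" by (simp add: ln_powr)
  have i: "integrable (measure_pmf p) (\<lambda>x. ln (pmf p x powr e))" unfolding eq using int by simp
  have "measure_pmf.expectation p (\<lambda>x. ln (pmf p x powr e)) \<le> ln (\<Sum>\<^sub>\<infinity>x. pmf p x powr (1 + e))"
    by (rule expectation_ln_le[OF i renyi_sum_expectation(1)[OF e]])
      (use renyi_sum_expectation(2,3)[OF e, of p] in \<open>auto simp: set_pmf_iff\<close>)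
  then show ?thesis by (simp only: eq integral_mult_right_zero)
qed

lemma expectation_pmf_pos:
  fixes f :: "'x \<Rightarrow> real"
  assumes "integrable (measure_pmf p) f" "\<And>x. f x > 0"
  shows "measure_pmf.expectation p f > 0"
proof -
  obtain x where x: "x \<in> set_pmf p" using set_pmf_not_empty[of p] by blast
  then have "0 < pmf p x * f x" using assms(2) by (simp add: pmf_positive)
  also have "\<dots> \<le> measure_pmf.expectation p f"
    using finite_sum_le_has_sum[OF has_sum_expectation_pmf[OF assms(1)], of "{x}"] assms(2)
    by (simp add: less_imp_le)
  finally show ?thesis .
qed

text \<open>By convexity of exp (e z) in e, its difference quotient at 0 lies between the tangent
  slope and the chord up to e = 1.\<close>

lemma exp_mult_bounds:
  fixes z :: real
  assumes "0 < e" "e \<le> 1"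
  shows "z \<le> (exp (e * z) - 1) / e" "(exp (e * z) - 1) / e \<le> exp z - 1"
proof -
  show "z \<le> (exp (e * z) - 1) / e" using assms exp_ge_add_one_self[of "e * z"] by (simp add: field_simps)
  have "1 powr (1 - e) * exp z powr e \<le> (1 - e) * 1 + e * exp z"
    using assms by (intro Youngs_inequality_0) auto
  then show "(exp (e * z) - 1) / e \<le> exp z - 1" using assms by (simp add: powr_def field_simps)
qed

text \<open>The right derivative at 0 of the logarithmic moment generating function is the mean, of
  which only the upper bound is kept. Integrability at e = 1 controls all smaller e by
  \<open>exp_mult_bounds\<close>.\<close>

lemma log_mgf_right_derivative:
  fixes Z :: "'x \<Rightarrow> real"
  assumes Z: "integrable (measure_pmf p) Z" and eZ: "integrable (measure_pmf p) (\<lambda>x. exp (Z x))"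
  shows "\<And>e. 0 < e \<Longrightarrow> e \<le> 1 \<Longrightarrow> integrable (measure_pmf p) (\<lambda>x. exp (e * Z x))"
    and "d > 0 \<Longrightarrow> \<forall>\<^sub>F e in at_right 0.
      ln (measure_pmf.expectation p (\<lambda>x. exp (e * Z x))) / e \<le> measure_pmf.expectation p Z + d"
proof -
  show int: "integrable (measure_pmf p) (\<lambda>x. exp (e * Z x))" if e: "0 < e" "e \<le> 1" for e
  proof (rule Bochner_Integration.integrable_bound)
    show "integrable (measure_pmf p) (\<lambda>x. 1 + exp (Z x))" using eZ by simp
    have "norm (exp (e * Z x)) \<le> norm (1 + exp (Z x))" for x
    proof -
      have "exp (e * Z x) \<le> 1 + e * (exp (Z x) - 1)" using exp_mult_bounds(2)[OF e, of "Z x"] e by (simp add: field_simps)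
      also have "e * (exp (Z x) - 1) \<le> e * exp (Z x)" using e by simp
      also have "\<dots> \<le> exp (Z x)" using e by simp
      finally have "exp (e * Z x) \<le> 1 + exp (Z x)" by simp
      also have "\<dots> \<le> \<bar>1 + exp (Z x)\<bar>" by (rule abs_ge_self)
      finally show ?thesis by simp
    qed
    then show "AE x in measure_pmf p. norm (exp (e * Z x)) \<le> norm (1 + exp (Z x))" by (intro AE_I2)
  qed simp
  assume d: "d > 0"
  \<comment> \<open>Dominated convergence for the difference quotients in the variable t = 1/e, so
    that e tending to 0 from the right becomes t tending to \<infinity>.\<close>
  have lim: "((\<lambda>t. measure_pmf.expectation p (\<lambda>x. (exp (Z x / t) - 1) * t)) \<longlongrightarrow> measure_pmf.expectation p Z) at_top"
  proof (rule integral_dominated_convergence_at_top[where w = "\<lambda>x. \<bar>Z x\<bar> + exp (Z x) + 1"])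
    show "integrable (measure_pmf p) (\<lambda>x. \<bar>Z x\<bar> + exp (Z x) + 1)" using Z eZ by auto
    show "AE x in measure_pmf p. ((\<lambda>t. (exp (Z x / t) - 1) * t) \<longlongrightarrow> Z x) at_top"
    proof (rule AE_I2)
      fix x
      show "((\<lambda>t. (exp (Z x / t) - 1) * t) \<longlongrightarrow> Z x) at_top"
        by (cases "Z x = 0") real_asymp+
    qed
    show "\<forall>\<^sub>F t in at_top. AE x in measure_pmf p. norm ((exp (Z x / t) - 1) * t) \<le> \<bar>Z x\<bar> + exp (Z x) + 1"
      using eventually_ge_at_top[of 1]
    proof eventually_elim
      case (elim t)
      have "norm ((exp (Z x / t) - 1) * t) \<le> \<bar>Z x\<bar> + exp (Z x) + 1" for x
      proof -
        have "Z x \<le> (exp (Z x / t) - 1) * t" "(exp (Z x / t) - 1) * t \<le> exp (Z x) - 1"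
          using exp_mult_bounds[of "1 / t" "Z x"] elim by simp_all
        then show ?thesis unfolding real_norm_def using exp_gt_zero[of "Z x"] by linarith
      qed
      then show ?case by simp
    qed
  qed simp_all
  then have "\<forall>\<^sub>F t in at_top. measure_pmf.expectation p (\<lambda>x. (exp (Z x / t) - 1) * t) < measure_pmf.expectation p Z + d"
    using d by (intro order_tendstoD) auto
  then have "\<forall>\<^sub>F e in at_right 0. measure_pmf.expectation p (\<lambda>x. (exp (Z x / inverse e) - 1) * inverse e)
      < measure_pmf.expectation p Z + d"
    using filterlim_inverse_at_top_right by (auto simp: filterlim_iff)
  moreover have "\<forall>\<^sub>F e in at_right 0. e \<in> {0<..<(1::real)}" by (rule eventually_at_right_real) simp
  ultimately show "\<forall>\<^sub>F e in at_right 0.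
      ln (measure_pmf.expectation p (\<lambda>x. exp (e * Z x))) / e \<le> measure_pmf.expectation p Z + d"
  proof eventually_elim
    case (elim e)
    then have e: "0 < e" "e \<le> 1" by auto
    let ?M = "measure_pmf.expectation p (\<lambda>x. exp (e * Z x))"
    have "?M > 0" using int[OF e] by (rule expectation_pmf_pos) simp
    \<comment> \<open>Since only an upper bound is wanted, ln M <= M - 1 replaces the logarithm by
      the difference quotient.\<close>
    then have "ln ?M \<le> ?M - 1" by (rule ln_le_minus_one)
    then have "ln ?M / e \<le> (?M - 1) / e" using e by (intro divide_right_mono) auto
    also have "\<dots> = measure_pmf.expectation p (\<lambda>x. (exp (Z x / inverse e) - 1) * inverse e)"
      using int[OF e] by (simp add: field_simps)
    finally show ?case using elim by simp
  qed
qed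

section \<open>Entropy, moments and spectral radius of the walk\<close>

lemma integrable_pmf_iff_nn_integral:
  fixes f :: "'x \<Rightarrow> real"
  assumes "\<And>x. f x \<ge> 0"
  shows "integrable (measure_pmf p) f \<longleftrightarrow> (\<integral>\<^sup>+x. ennreal (f x) \<partial>measure_pmf p) < \<infinity>"
  using assms by (simp add: integrable_iff_bounded)

lemma integrable_return_pmf: "integrable (measure_pmf (return_pmf x)) (f :: 'x \<Rightarrow> real)"
  by (rule integrable_pmf_bounded[where c = "\<bar>f x\<bar>"]) simp

context coset_random_walk begin

text \<open>Entropy is additive for independent pairs and does not increase under multiplication in
  G.\<close>

lemma m_entropy:
  assumes "integrable (measure_pmf \<mu>) (\<lambda>g. - ln (pmf \<mu> g))"
  shows "integrable (measure_pmf (m n)) (\<lambda>g. - ln (pmf (m n) g)) \<and>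
    measure_pmf.expectation (m n) (\<lambda>g. - ln (pmf (m n) g)) \<le> real n * measure_pmf.expectation \<mu> (\<lambda>g. - ln (pmf \<mu> g))"
proof (induction n)
  case 0
  show ?case by (simp add: integrable_return_pmf)
next
  case (Suc n)
  note pr = entropy_pair_pmf[OF assms conjunct1[OF Suc]]
  note mp = entropy_map_pmf[OF pr(1), of "\<lambda>(g, h). g \<otimes> h"]
  show ?case using mp pr(2) Suc by (simp add: convolve_pmf_def distrib_right)
qed

lemma \<nu>_entropy:
  assumes "integrable (measure_pmf \<mu>) (\<lambda>g. - ln (pmf \<mu> g))"
  shows "integrable (measure_pmf (\<nu> n)) (\<lambda>x. - ln (pmf (\<nu> n) x))"
    and "measure_pmf.expectation (\<nu> n) (\<lambda>x. - ln (pmf (\<nu> n) x)) \<le> real n * measure_pmf.expectation \<mu> (\<lambda>g. - ln (pmf \<mu> g))"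
  using entropy_map_pmf[of "m n" "\<lambda>g. g <# H"] m_entropy[OF assms, of n] by (auto simp: coset_walk_def)

text \<open>For a submultiplicative weight only finiteness is passed on. Growth in n is harmless,
  because n stays fixed while e tends to 0.\<close>

lemma moment_power:
  fixes w :: "'a \<Rightarrow> real"
  assumes w: "\<And>g. w g \<ge> 0" and sub: "\<And>g h. g \<in> carrier G \<Longrightarrow> h \<in> carrier G \<Longrightarrow> w (g \<otimes> h) \<le> w g * w h"
    and int: "integrable (measure_pmf \<mu>) w"
  shows "integrable (measure_pmf (m n)) w"
proof (induction n)
  case 0
  show ?case by (simp add: integrable_return_pmf)
next
  case (Suc n)
  have "(\<integral>\<^sup>+g. ennreal (w g) \<partial>measure_pmf (m (Suc n)))
     = (\<integral>\<^sup>+g. \<integral>\<^sup>+h. ennreal (w (g \<otimes> h)) \<partial>measure_pmf (m n) \<partial>measure_pmf \<mu>)"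
    by (simp add: convolve_pmf_def nn_integral_pair_pmf')
  also have "\<dots> \<le> (\<integral>\<^sup>+g. \<integral>\<^sup>+h. ennreal (w g) * ennreal (w h) \<partial>measure_pmf (m n) \<partial>measure_pmf \<mu>)"
    using support support_m[of n] sub w
    by (intro nn_integral_mono_AE) (auto simp: AE_measure_pmf_iff ennreal_mult[symmetric] subset_iff intro!: nn_integral_mono_AE ennreal_leI)
  also have "\<dots> = (\<integral>\<^sup>+g. ennreal (w g) \<partial>measure_pmf \<mu>) * (\<integral>\<^sup>+h. ennreal (w h) \<partial>measure_pmf (m n))"
    by (simp add: nn_integral_cmult nn_integral_multc)
  also have "\<dots> < \<infinity>" using int Suc w by (simp add: integrable_pmf_iff_nn_integral ennreal_mult_less_top)
  finally show ?case using w by (simp add: integrable_pmf_iff_nn_integral)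
qed

text \<open>For a subadditive weight the growth in n is linear; this quantitative form yields the
  logarithmic bound in \<open>log_moment\<close>. The term w(1) is the value at n = 0, where the law
  is a point mass at the identity.\<close>

lemma moment_sum:
  fixes w :: "'a \<Rightarrow> real"
  assumes w: "\<And>g. w g \<ge> 0" and sub: "\<And>g h. g \<in> carrier G \<Longrightarrow> h \<in> carrier G \<Longrightarrow> w (g \<otimes> h) \<le> w g + w h"
    and int: "integrable (measure_pmf \<mu>) w"
  shows "integrable (measure_pmf (m n)) w"
    and "measure_pmf.expectation (m n) w \<le> real n * measure_pmf.expectation \<mu> w + w \<one>"
proof -
  let ?K = "measure_pmf.expectation \<mu> w"
  have K0: "?K \<ge> 0" using w by simp
  have nn: "(\<integral>\<^sup>+g. ennreal (w g) \<partial>measure_pmf (m n)) \<le> ennreal (real n * ?K + w \<one>)"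
  proof (induction n)
    case (Suc n)
    have "(\<integral>\<^sup>+g. ennreal (w g) \<partial>measure_pmf (m (Suc n)))
       = (\<integral>\<^sup>+g. \<integral>\<^sup>+h. ennreal (w (g \<otimes> h)) \<partial>measure_pmf (m n) \<partial>measure_pmf \<mu>)"
      by (simp add: convolve_pmf_def nn_integral_pair_pmf')
    also have "\<dots> \<le> (\<integral>\<^sup>+g. \<integral>\<^sup>+h. ennreal (w g) + ennreal (w h) \<partial>measure_pmf (m n) \<partial>measure_pmf \<mu>)"
      using support support_m[of n] sub w
      by (intro nn_integral_mono_AE) (auto simp: AE_measure_pmf_iff ennreal_plus[symmetric] subset_iff simp del: ennreal_plus intro!: nn_integral_mono_AE ennreal_leI)
    also have "\<dots> = (\<integral>\<^sup>+g. ennreal (w g) \<partial>measure_pmf \<mu>) + (\<integral>\<^sup>+h. ennreal (w h) \<partial>measure_pmf (m n))"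
      by (simp add: nn_integral_add measure_pmf.emeasure_space_1[simplified])
    also have "(\<integral>\<^sup>+g. ennreal (w g) \<partial>measure_pmf \<mu>) = ennreal ?K"
      using int w by (intro nn_integral_eq_integral) auto
    also have "ennreal ?K + (\<integral>\<^sup>+h. ennreal (w h) \<partial>measure_pmf (m n)) \<le> ennreal ?K + ennreal (real n * ?K + w \<one>)"
      using Suc by (rule add_left_mono)
    also have "\<dots> = ennreal (real (Suc n) * ?K + w \<one>)"
      using K0 w by (simp add: ennreal_plus[symmetric] algebra_simps del: ennreal_plus)
    finally show ?case .
  qed (use w in simp)
  then show i: "integrable (measure_pmf (m n)) w"
    unfolding integrable_pmf_iff_nn_integral[OF w] by (rule le_less_trans) simp
  have "ennreal (measure_pmf.expectation (m n) w) \<le> ennreal (real n * ?K + w \<one>)"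
    using nn i w by (subst nn_integral_eq_integral[symmetric]) auto
  then show "measure_pmf.expectation (m n) w \<le> real n * ?K + w \<one>"
    using K0 w[of \<one>] by (subst (asm) ennreal_le_iff) auto
qed

abbreviation opn where "opn q n \<equiv> lq_opnorm q X (T ^^ n)"
abbreviation \<rho> where "\<rho> \<equiv> quasi_regular_radius G H \<mu>"

lemma opnorm_pos:
  assumes "e > 0" shows "opn (1 + e) n > 0"
proof -
  have "0 < opn (1 + e) n powr (1 + e)"
    using less_le_trans[OF renyi_sum_expectation(3)[OF assms] renyi_sum_le_opnorm] assms by simp
  then have "opn (1 + e) n \<noteq> 0" by auto
  then show ?thesis using opnorm_nonneg[of "1 + e" n] assms by (simp add: less_le)
qed

lemma ln_renyi_le:
  assumes "e > 0"
  shows "ln (\<Sum>\<^sub>\<infinity>x. pmf (\<nu> n) x powr (1 + e)) \<le> (1 + e) * ln (opn (1 + e) n)"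
proof -
  have "ln (\<Sum>\<^sub>\<infinity>x. pmf (\<nu> n) x powr (1 + e)) \<le> ln (opn (1 + e) n powr (1 + e))"
    using renyi_sum_le_opnorm[of "1 + e" n] renyi_sum_expectation(3)[OF assms, of "\<nu> n"] assms by (subst ln_le_cancel_iff) auto
  then show ?thesis using opnorm_pos[OF assms] by (simp add: ln_powr)
qed

text \<open>Fekete for the logarithms of the operator norms. The second part is the essential gain:
  the radius is bounded by every single power.\<close>

lemma radius_limit:
  assumes h: "integrable (measure_pmf \<mu>) (\<lambda>g. - ln (pmf \<mu> g))" and e: "e > 0"
  shows "(\<lambda>n. ln (opn (1 + e) n) / real n) \<longlonglongrightarrow> ln (\<rho> (1 + e))"
    and "n \<ge> 1 \<Longrightarrow> ln (\<rho> (1 + e)) \<le> ln (opn (1 + e) n) / real n"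
proof -
  define h where "h = measure_pmf.expectation \<mu> (\<lambda>g. - ln (pmf \<mu> g))"
  have sub: "ln (opn (1 + e) (k + n)) \<le> ln (opn (1 + e) k) + ln (opn (1 + e) n)" for k n
  proof -
    have "ln (opn (1 + e) (k + n)) \<le> ln (opn (1 + e) k * opn (1 + e) n)"
      using opnorm_submult[of "1 + e" k n] opnorm_pos[OF e] e by (subst ln_le_cancel_iff) auto
    then show ?thesis using opnorm_pos[OF e, of k] opnorm_pos[OF e, of n] by (simp add: ln_mult)
  qed
  \<comment> \<open>Finite entropy keeps the radius positive: |T^n|^(1 + e) is at least the Renyi
    sum, which is at least exp (- e H(nu_n)), and H(nu_n) <= n H(mu).\<close>
  have lb: "ln (opn (1 + e) n) \<ge> - (e / (1 + e) * h) * real n" for n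
  proof -
    have "- e * (real n * h) \<le> - e * measure_pmf.expectation (\<nu> n) (\<lambda>x. - ln (pmf (\<nu> n) x))"
      using \<nu>_entropy(2)[OF h, of n] e by (simp add: h_def)
    also have "\<dots> \<le> (1 + e) * ln (opn (1 + e) n)"
      using renyi_le_shannon[OF \<nu>_entropy(1)[OF h] e, of n] ln_renyi_le[OF e, of n] by linarith
    finally show ?thesis using e by (simp add: field_simps)
  qed
  obtain L where L: "(\<lambda>n. ln (opn (1 + e) n) / real n) \<longlonglongrightarrow> L"
      "\<And>n. n \<ge> 1 \<Longrightarrow> L \<le> ln (opn (1 + e) n) / real n"
    using subadditive_tendsto[of "\<lambda>n. ln (opn (1 + e) n)", OF sub lb] by blast
  \<comment> \<open>This includes n = 0, where 1 / real 0 = 0 makes both sides 1.\<close>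
  have "(\<lambda>n. opn (1 + e) n powr (1 / real n)) = (\<lambda>n. exp (ln (opn (1 + e) n) / real n))"
    using opnorm_pos[OF e] by (intro ext) (simp add: powr_def less_imp_neq[THEN not_sym])
  then have "(\<lambda>n. opn (1 + e) n powr (1 / real n)) \<longlonglongrightarrow> exp L" using tendsto_exp[OF L(1)] by simp
  then have "\<rho> (1 + e) = exp L" unfolding quasi_regular_radius_def by (rule limI)
  then show "(\<lambda>n. ln (opn (1 + e) n) / real n) \<longlonglongrightarrow> ln (\<rho> (1 + e))"
    "n \<ge> 1 \<Longrightarrow> ln (\<rho> (1 + e)) \<le> ln (opn (1 + e) n) / real n" using L by simp_all
qed

text \<open>With \<open>\<alpha> = 1 + e\<close> and \<open>p = \<alpha> / (\<alpha> - 1) = (1 + e) / e\<close>, this is \<open>- p ln r\<^sub>\<alpha>(\<mu>)\<close>.\<close>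

definition renyi_radius :: "real \<Rightarrow> real" where
  "renyi_radius e = - ((1 + e) / e) * ln (\<rho> (1 + e))"

lemma renyi_radius_limit:
  assumes h: "integrable (measure_pmf \<mu>) (\<lambda>g. - ln (pmf \<mu> g))" and e: "e > 0"
  shows "(\<lambda>n. - ((1 + e) / e) * (ln (opn (1 + e) n) / real n)) \<longlonglongrightarrow> renyi_radius e"
  unfolding renyi_radius_def by (intro tendsto_mult tendsto_const radius_limit(1)[OF h e])

lemma renyi_seq_eq:
  "renyi_seq G H \<mu> (1 + e) n = - (1 / e) * ln (\<Sum>\<^sub>\<infinity>x. pmf (\<nu> n) x powr (1 + e)) / real n"
  by (simp add: renyi_seq_def renyi_entropy_def)

lemma renyi_seq_ge:
  assumes "e > 0"
  shows "- ((1 + e) / e) * (ln (opn (1 + e) n) / real n) \<le> renyi_seq G H \<mu> (1 + e) n"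
proof -
  have "ln (\<Sum>\<^sub>\<infinity>x. pmf (\<nu> n) x powr (1 + e)) / real n / e \<le> (1 + e) * ln (opn (1 + e) n) / real n / e"
    using ln_renyi_le[OF assms, of n] assms by (intro divide_right_mono) auto
  then show ?thesis unfolding renyi_seq_eq by (simp add: mult.commute)
qed

lemma renyi_seq_le:
  assumes h: "integrable (measure_pmf \<mu>) (\<lambda>g. - ln (pmf \<mu> g))" and e: "e > 0"
  shows "renyi_seq G H \<mu> (1 + e) n \<le> measure_pmf.expectation (\<nu> n) (\<lambda>x. - ln (pmf (\<nu> n) x)) / real n"
proof -
  have "- (1 / e) * ln (\<Sum>\<^sub>\<infinity>x. pmf (\<nu> n) x powr (1 + e)) \<le> measure_pmf.expectation (\<nu> n) (\<lambda>x. - ln (pmf (\<nu> n) x))"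
    using renyi_le_shannon[OF \<nu>_entropy(1)[OF h] e, of n] e by (simp add: field_simps)
  then show ?thesis unfolding renyi_seq_eq by (rule divide_right_mono) simp
qed

text \<open>Here n is fixed and e tends to 0: the logarithm of the interpolated bound, divided by e,
  approaches the mean of \<open>Z\<close>, with slack \<open>d\<close> for the limit.\<close>

lemma renyi_radius_ge:
  assumes h: "integrable (measure_pmf \<mu>) (\<lambda>g. - ln (pmf \<mu> g))"
    and rd: "pair_rapid_decay G H l C s" and s: "s > 0"
    and w: "integrable (measure_pmf (m n)) (\<lambda>g. (1 + real (l g)) powr (2 * s))"
    and lw: "integrable (measure_pmf (m n)) (\<lambda>g. ln (1 + real (l g)))"
    and n: "n \<ge> 1" and d: "d > 0"
  shows "\<forall>\<^sub>F e in at_right 0. (measure_pmf.expectation (\<nu> n) (\<lambda>x. - ln (pmf (\<nu> n) x))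
     - 2 * s * measure_pmf.expectation (m n) (\<lambda>g. ln (1 + real (l g))) - 2 * ln C - d) / real n \<le> renyi_radius e"
proof -
  have C: "C > 0" using rd by (simp add: pair_rapid_decay_def)
  \<comment> \<open>On the support of \<open>m n\<close> the coset has positive probability, and
    \<open>exp (e * Z g)\<close> is the integrand of \<open>opnorm_rapid_decay\<close>; elsewhere
    the convention ln 0 = 0 affects only a null set.\<close>
  define Z where "Z g = ln (pmf (\<nu> n) (g <# H)) + 2 * s * ln (1 + real (l g))" for g
  have Z1: "integrable (measure_pmf (m n)) (\<lambda>g. - ln (pmf (\<nu> n) (g <# H)))"
    using \<nu>_entropy(1)[OF h, of n] unfolding coset_walk_def by (subst (asm) integrable_map_pmf_eq)
  then have Z1': "integrable (measure_pmf (m n)) (\<lambda>g. ln (pmf (\<nu> n) (g <# H)))"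
    using Bochner_Integration.integrable_minus by fastforce
  have Zi: "integrable (measure_pmf (m n)) Z" unfolding Z_def using Z1' lw by auto
  have EZ: "measure_pmf.expectation (m n) Z = - measure_pmf.expectation (\<nu> n) (\<lambda>x. - ln (pmf (\<nu> n) x))
      + 2 * s * measure_pmf.expectation (m n) (\<lambda>g. ln (1 + real (l g)))"
  proof -
    have "measure_pmf.expectation (m n) Z = measure_pmf.expectation (m n) (\<lambda>g. ln (pmf (\<nu> n) (g <# H)))
      + 2 * s * measure_pmf.expectation (m n) (\<lambda>g. ln (1 + real (l g)))"
      unfolding Z_def using Z1' lw by (subst Bochner_Integration.integral_add) auto
    moreover have "measure_pmf.expectation (\<nu> n) (\<lambda>x. ln (pmf (\<nu> n) x)) = measure_pmf.expectation (m n) (\<lambda>g. ln (pmf (\<nu> n) (g <# H)))"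
      unfolding coset_walk_def by (rule integral_map_pmf)
    ultimately show ?thesis by simp
  qed
  have pos: "pmf (\<nu> n) (g <# H) > 0" if "g \<in> set_pmf (m n)" for g
    using that by (intro pmf_positive) (auto simp: coset_walk_def)
  have W: "(pmf (\<nu> n) (g <# H) * (1 + real (l g)) powr (2 * s)) powr e = exp (e * Z g)"
    if "g \<in> set_pmf (m n)" for e g
    using pos[OF that] by (simp add: Z_def powr_def ln_mult exp_add algebra_simps)
  \<comment> \<open>The coset probability is at most 1, so the moment of order 2s dominates
    \<open>exp (Z g)\<close>.\<close>
  have eZ: "integrable (measure_pmf (m n)) (\<lambda>g. exp (Z g))"
  proof (rule Bochner_Integration.integrable_bound[OF w])
    show "AE g in measure_pmf (m n). norm (exp (Z g)) \<le> norm ((1 + real (l g)) powr (2 * s))"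
      unfolding AE_measure_pmf_iff
    proof
      fix g assume g: "g \<in> set_pmf (m n)"
      have "exp (Z g) = pmf (\<nu> n) (g <# H) * (1 + real (l g)) powr (2 * s)" using W[OF g, of 1] pos[OF g] by simp
      also have "\<dots> \<le> 1 * (1 + real (l g)) powr (2 * s)" by (intro mult_right_mono pmf_le_1) auto
      finally show "norm (exp (Z g)) \<le> norm ((1 + real (l g)) powr (2 * s))" by simp
    qed
  qed simp
  have "\<forall>\<^sub>F e in at_right 0. ln (measure_pmf.expectation (m n) (\<lambda>g. exp (e * Z g))) / e \<le> measure_pmf.expectation (m n) Z + d"
    using log_mgf_right_derivative(2)[OF Zi eZ d] .
  moreover have "\<forall>\<^sub>F e in at_right 0. e \<in> {0<..<(1::real)}" by (rule eventually_at_right_real) simp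
  ultimately show ?thesis
  proof eventually_elim
    case (elim e)
    then have e: "0 < e" "e \<le> 1" by auto
    let ?W = "\<lambda>g. (pmf (\<nu> n) (g <# H) * (1 + real (l g)) powr (2 * s)) powr e"
    define M where "M = measure_pmf.expectation (m n) (\<lambda>g. exp (e * Z g))"
    have iZ: "integrable (measure_pmf (m n)) (\<lambda>g. exp (e * Z g))"
      by (rule log_mgf_right_derivative(1)[OF Zi eZ e])
    have AE: "AE g in measure_pmf (m n). ?W g = exp (e * Z g)" using W by (auto simp: AE_measure_pmf_iff)
    have iW: "integrable (measure_pmf (m n)) ?W"
      using integrable_cong_AE[THEN iffD2, OF _ _ AE iZ] by simp
    have EW: "measure_pmf.expectation (m n) ?W = M" unfolding M_def using AE by (intro integral_cong_AE) auto
    have M: "M > 0" unfolding M_def using iZ by (rule expectation_pmf_pos) simp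
    have "ln (opn (1 + e) n powr (1 + e)) \<le> ln (C powr (2 * e) * M)"
      using opnorm_rapid_decay[OF rd e iW] opnorm_pos[OF e(1), of n] C M EW by (subst ln_le_cancel_iff) auto
    then have "(1 + e) * ln (opn (1 + e) n) \<le> 2 * e * ln C + ln M"
      using C M opnorm_pos[OF e(1), of n] by (simp add: ln_mult ln_powr)
    then have "(1 + e) * ln (opn (1 + e) n) / e \<le> (2 * e * ln C + ln M) / e"
      using e by (intro divide_right_mono) auto
    also have "\<dots> = 2 * ln C + ln M / e" using e by (simp add: add_divide_distrib)
    also have "\<dots> \<le> 2 * ln C + (measure_pmf.expectation (m n) Z + d)" using elim by (simp add: M_def)
    finally have le: "(1 + e) / e * ln (opn (1 + e) n) \<le> 2 * ln C + measure_pmf.expectation (m n) Z + d" by simp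
    \<comment> \<open>The radius is an infimum over powers, so the single power n suffices.\<close>
    have "(1 + e) / e * ln (\<rho> (1 + e)) \<le> (1 + e) / e * (ln (opn (1 + e) n) / real n)"
      using e n by (intro mult_left_mono radius_limit(2)[OF h e(1)]) auto
    also have "\<dots> \<le> (2 * ln C + measure_pmf.expectation (m n) Z + d) / real n"
      using divide_right_mono[OF le, of "real n"] by simp
    finally have "(1 + e) / e * ln (\<rho> (1 + e)) \<le> (2 * ln C + measure_pmf.expectation (m n) Z + d) / real n" .
    moreover have "(measure_pmf.expectation (\<nu> n) (\<lambda>x. - ln (pmf (\<nu> n) x))
     - 2 * s * measure_pmf.expectation (m n) (\<lambda>g. ln (1 + real (l g))) - 2 * ln C - d) / real n
     = - ((2 * ln C + measure_pmf.expectation (m n) Z + d) / real n)"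
      unfolding EZ minus_divide_left by (rule arg_cong[where f = "\<lambda>t. t / real n"]) linarith
    ultimately show ?case unfolding renyi_radius_def minus_mult_left[symmetric] by linarith
  qed
qed

text \<open>For c <= 1 the weight (1 + l)^c is subadditive, so its mean grows at most linearly in n;
  Jensen for \<open>ln\<close> then makes the mean logarithm of the length O(log n).\<close>

lemma log_moment:
  assumes l: "\<And>g h. g \<in> carrier G \<Longrightarrow> h \<in> carrier G \<Longrightarrow> l (g \<otimes> h) \<le> l g + l h"
    and c: "0 < c" "c \<le> 1" and int: "integrable (measure_pmf \<mu>) (\<lambda>g. (1 + real (l g)) powr c)"
  shows "integrable (measure_pmf (m n)) (\<lambda>g. ln (1 + real (l g)))"
    and "measure_pmf.expectation (m n) (\<lambda>g. ln (1 + real (l g)))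
      \<le> ln (real n * measure_pmf.expectation \<mu> (\<lambda>g. (1 + real (l g)) powr c) + (1 + real (l \<one>)) powr c) / c"
proof -
  let ?w = "\<lambda>g. (1 + real (l g)) powr c"
  let ?M = "real n * measure_pmf.expectation \<mu> ?w + ?w \<one>"
  have sub: "?w (g \<otimes> h) \<le> ?w g + ?w h" if "g \<in> carrier G" "h \<in> carrier G" for g h
  proof -
    have "?w (g \<otimes> h) \<le> ((1 + real (l g)) + (1 + real (l h))) powr c"
      using l[OF that] c by (intro powr_mono2) auto
    also have "\<dots> \<le> ?w g + ?w h" using c by (intro powr_add_subadditive) auto
    finally show ?thesis .
  qed
  have iw: "integrable (measure_pmf (m n)) ?w" and Ew: "measure_pmf.expectation (m n) ?w \<le> ?M"
    using moment_sum[of ?w n] sub int by auto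
  have lnw: "ln (?w g) = c * ln (1 + real (l g))" for g by (simp add: ln_powr)
  show i: "integrable (measure_pmf (m n)) (\<lambda>g. ln (1 + real (l g)))"
  proof (rule Bochner_Integration.integrable_bound)
    show "integrable (measure_pmf (m n)) (\<lambda>g. ?w g / c)" using iw by simp
    have "ln (1 + real (l g)) \<le> ?w g / c" for g
    proof -
      have "c * ln (1 + real (l g)) \<le> ?w g" unfolding lnw[symmetric]
        using ln_le_minus_one[of "?w g"] by (simp add: add_pos_nonneg)
      then show ?thesis using c by (simp add: field_simps)
    qed
    then show "AE g in measure_pmf (m n). norm (ln (1 + real (l g))) \<le> norm (?w g / c)" using c by simp
  qed simp
  have M: "?M > 0" by (intro add_nonneg_pos mult_nonneg_nonneg) (auto simp: add_pos_nonneg)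
  have "measure_pmf.expectation (m n) (\<lambda>g. ln (?w g)) \<le> ln ?M"
    using i iw Ew M by (intro expectation_ln_le) (auto simp: lnw)
  then have "c * measure_pmf.expectation (m n) (\<lambda>g. ln (1 + real (l g))) \<le> ln ?M" by (simp add: lnw)
  then show "measure_pmf.expectation (m n) (\<lambda>g. ln (1 + real (l g))) \<le> ln ?M / c"
    using c by (simp add: field_simps)
qed

text \<open>With bounded increments the length weight is at most a power of a linear function of n
  and can be pulled out of the expectation. What remains is exactly the Renyi sum, so for fixed e
  the operator norm and the Renyi sum differ by a polynomial factor, which disappears in the
  rate.\<close>

lemma renyi_seq_finite_support:
  assumes h: "integrable (measure_pmf \<mu>) (\<lambda>g. - ln (pmf \<mu> g))"
    and rd: "pair_rapid_decay G H l C s"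
    and l: "\<And>g h. g \<in> carrier G \<Longrightarrow> h \<in> carrier G \<Longrightarrow> l (g \<otimes> h) \<le> l g + l h"
    and fin: "finite (set_pmf \<mu>)" and e: "0 < e" "e \<le> 1"
  shows "renyi_seq G H \<mu> (1 + e) \<longlonglongrightarrow> renyi_radius e"
proof -
  have C: "C > 0" "s > 0" using rd by (auto simp: pair_rapid_decay_def)
  define R where "R = Max (l ` set_pmf \<mu>)"
  have R: "l g \<le> R" if "g \<in> set_pmf \<mu>" for g unfolding R_def using fin that by (intro Max_ge) auto
  \<comment> \<open>The constant \<open>l \<one>\<close> stays because \<open>l\<close> is only
    assumed subadditive.\<close>
  have lR: "l g \<le> n * R + l \<one>" if "g \<in> set_pmf (m n)" for g n
    using that
  proof (induction n arbitrary: g)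
    case (Suc n)
    then obtain a b where ab: "a \<in> set_pmf \<mu>" "b \<in> set_pmf (m n)" "g = a \<otimes> b" by (auto simp: convolve_pmf_def)
    have "l g \<le> l a + l b" using ab support support_m[of n] l by auto
    then show ?case using Suc.IH[OF ab(2)] R[OF ab(1)] by simp
  qed simp
  define t where "t n = 1 + (real n * real R + real (l \<one>))" for n
  have t: "t n > 0" for n by (simp add: t_def add_pos_nonneg)
  have ub: "renyi_seq G H \<mu> (1 + e) n \<le> - ((1 + e) / e) * (ln (opn (1 + e) n) / real n)
      + (2 * ln C + 2 * s * ln (t n)) / real n" for n
  proof -
    let ?W = "\<lambda>g. (pmf (\<nu> n) (g <# H) * (1 + real (l g)) powr (2 * s)) powr e"
    let ?S = "\<Sum>\<^sub>\<infinity>x. pmf (\<nu> n) x powr (1 + e)"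
    have S: "?S > 0" "?S = measure_pmf.expectation (m n) (\<lambda>g. pmf (\<nu> n) (g <# H) powr e)"
      using renyi_sum_expectation[OF e(1), of "\<nu> n"] by (auto simp: coset_walk_def)
    have W: "?W g \<le> t n powr (2 * s * e) * pmf (\<nu> n) (g <# H) powr e" if "g \<in> set_pmf (m n)" for g
    proof -
      have "real (l g) \<le> real (n * R + l \<one>)" using lR[OF that] by (rule of_nat_mono)
      then have "(1 + real (l g)) powr (2 * s * e) \<le> t n powr (2 * s * e)"
        using C e by (intro powr_mono2) (auto simp: t_def)
      then have "(1 + real (l g)) powr (2 * s * e) * pmf (\<nu> n) (g <# H) powr e \<le> t n powr (2 * s * e) * pmf (\<nu> n) (g <# H) powr e"
        by (rule mult_right_mono) simp
      then show ?thesis by (simp add: powr_mult powr_powr mult.commute)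
    qed
    have i1: "integrable (measure_pmf (m n)) (\<lambda>g. pmf (\<nu> n) (g <# H) powr e)"
      using e by (intro integrable_pmf_bounded[where c = 1]) (auto intro!: powr_le1 pmf_le_1)
    then have i2: "integrable (measure_pmf (m n)) (\<lambda>g. t n powr (2 * s * e) * pmf (\<nu> n) (g <# H) powr e)" by simp
    have iW: "integrable (measure_pmf (m n)) ?W"
      by (rule Bochner_Integration.integrable_bound[OF i2]) (use W in \<open>auto simp: AE_measure_pmf_iff\<close>)
    have "measure_pmf.expectation (m n) ?W \<le> measure_pmf.expectation (m n) (\<lambda>g. t n powr (2 * s * e) * pmf (\<nu> n) (g <# H) powr e)"
      using iW i2 W by (intro integral_mono_AE) (auto simp: AE_measure_pmf_iff)
    also have "\<dots> = t n powr (2 * s * e) * ?S" using S(2) by simp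
    finally have EW: "measure_pmf.expectation (m n) ?W \<le> t n powr (2 * s * e) * ?S" .
    have "opn (1 + e) n powr (1 + e) \<le> C powr (2 * e) * measure_pmf.expectation (m n) ?W"
      by (rule opnorm_rapid_decay[OF rd e iW])
    also have "\<dots> \<le> C powr (2 * e) * (t n powr (2 * s * e) * ?S)" using EW by (rule mult_left_mono) simp
    finally have "ln (opn (1 + e) n powr (1 + e)) \<le> ln (C powr (2 * e) * (t n powr (2 * s * e) * ?S))"
      using opnorm_pos[OF e(1), of n] C S(1) t[of n] by (subst ln_le_cancel_iff) auto
    then have "(1 + e) * ln (opn (1 + e) n) \<le> 2 * e * ln C + 2 * s * e * ln (t n) + ln ?S"
      using opnorm_pos[OF e(1), of n] C S(1) t[of n] by (simp add: ln_mult ln_powr)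
    then have "- (ln ?S) / e \<le> (2 * e * ln C + 2 * s * e * ln (t n) - (1 + e) * ln (opn (1 + e) n)) / e"
      using e by (intro divide_right_mono) auto
    also have "\<dots> = 2 * ln C + 2 * s * ln (t n) - (1 + e) / e * ln (opn (1 + e) n)"
      using e by (simp add: field_simps)
    finally have "- (ln ?S) / e / real n \<le> (2 * ln C + 2 * s * ln (t n) - (1 + e) / e * ln (opn (1 + e) n)) / real n"
      by (rule divide_right_mono) simp
    then show ?thesis unfolding renyi_seq_eq by (simp add: diff_divide_distrib)
  qed
  \<comment> \<open>\<open>ln (t n)\<close> is constant in n for R = 0 and of order ln n otherwise,
    so the two asymptotics are computed separately.\<close>
  have "(\<lambda>n. (2 * ln C + 2 * s * ln (t n)) / real n) \<longlonglongrightarrow> 0"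
  proof (cases "R = 0")
    case True
    then show ?thesis unfolding t_def by simp real_asymp
  next
    case False
    then have "real R > 0" by simp
    moreover define r b where "r = real R" and "b = real (l \<one>)"
    ultimately show ?thesis unfolding t_def r_def[symmetric] b_def[symmetric] by real_asymp
  qed
  then have "(\<lambda>n. - ((1 + e) / e) * (ln (opn (1 + e) n) / real n) + (2 * ln C + 2 * s * ln (t n)) / real n)
      \<longlonglongrightarrow> renyi_radius e + 0"
    by (intro tendsto_add renyi_radius_limit[OF h e(1)])
  then have "(\<lambda>n. - ((1 + e) / e) * (ln (opn (1 + e) n) / real n) + (2 * ln C + 2 * s * ln (t n)) / real n)
      \<longlonglongrightarrow> renyi_radius e" by simp
  then show ?thesis
    by (rule tendsto_sandwich[rotated 3]) (use ub renyi_seq_ge[OF e(1)] renyi_radius_limit[OF h e(1)] in auto)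
qed

end

section \<open>Word length and the limits\<close>

lemma (in group) foldr_mult_append:
  assumes "set vs \<subseteq> carrier G" "set ws \<subseteq> carrier G"
  shows "foldr (\<lambda>a b. a \<otimes> b) (vs @ ws) \<one> = foldr (\<lambda>a b. a \<otimes> b) vs \<one> \<otimes> foldr (\<lambda>a b. a \<otimes> b) ws \<one>"
proof -
  have cl: "foldr (\<lambda>a b. a \<otimes> b) us \<one> \<in> carrier G" if "set us \<subseteq> carrier G" for us
    using that by (induction us) auto
  show "foldr (\<lambda>a b. a \<otimes> b) (vs @ ws) \<one> = foldr (\<lambda>a b. a \<otimes> b) vs \<one> \<otimes> foldr (\<lambda>a b. a \<otimes> b) ws \<one>"
    using assms by (induction vs) (auto simp: cl m_assoc)
qed

text \<open>Symmetry of \<open>S\<close> makes the inverses allowed in \<open>generate\<close> into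
  letters.\<close>

lemma (in group) generate_word:
  assumes S: "S \<subseteq> carrier G" "\<forall>s\<in>S. inv s \<in> S" and "g \<in> generate G S"
  shows "\<exists>ws. set ws \<subseteq> S \<and> foldr (\<lambda>a b. a \<otimes> b) ws \<one> = g"
  using assms(3)
proof induction
  case one
  show ?case by (intro exI[of _ "[]"]) simp
next
  case (incl h)
  then show ?case using S by (intro exI[of _ "[h]"]) auto
next
  case (inv h)
  then show ?case using S by (intro exI[of _ "[inv h]"]) auto
next
  case (eng h1 h2)
  then obtain vs ws where "set vs \<subseteq> S" "foldr (\<lambda>a b. a \<otimes> b) vs \<one> = h1"
    "set ws \<subseteq> S" "foldr (\<lambda>a b. a \<otimes> b) ws \<one> = h2" by blast
  then show ?case using foldr_mult_append[of vs ws] S(1)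
    by (intro exI[of _ "vs @ ws"]) auto
qed

lemma (in group) word_length_mult:
  assumes S: "symmetric_generating_set G S" and g: "g \<in> carrier G" and h: "h \<in> carrier G"
  shows "word_length G S (g \<otimes> h) \<le> word_length G S g + word_length G S h"
proof -
  \<comment> \<open>The minimum in \<open>word_length\<close> is attained because \<open>S\<close>
    generates; then words are concatenated.\<close>
  have word: "\<exists>ws. set ws \<subseteq> S \<and> length ws = word_length G S g \<and> foldr (\<lambda>a b. a \<otimes> b) ws \<one> = g"
    if "g \<in> carrier G" for g
  proof -
    have "\<exists>n ws. set ws \<subseteq> S \<and> length ws = n \<and> foldr (\<lambda>a b. a \<otimes> b) ws \<one> = g"
      using generate_word[of S g] S that by (auto simp: symmetric_generating_set_def)
    then show ?thesis unfolding word_length_def by (rule LeastI_ex)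
  qed
  obtain vs ws where vs: "set vs \<subseteq> S" "length vs = word_length G S g" "foldr (\<lambda>a b. a \<otimes> b) vs \<one> = g"
    and ws: "set ws \<subseteq> S" "length ws = word_length G S h" "foldr (\<lambda>a b. a \<otimes> b) ws \<one> = h"
    using word[OF g] word[OF h] by blast
  have "foldr (\<lambda>a b. a \<otimes> b) (vs @ ws) \<one> = g \<otimes> h"
    using foldr_mult_append[of vs ws] vs ws S by (auto simp: symmetric_generating_set_def)
  then have "\<exists>us. set us \<subseteq> S \<and> length us = word_length G S g + word_length G S h \<and> foldr (\<lambda>a b. a \<otimes> b) us \<one> = g \<otimes> h"
    using vs ws by (intro exI[of _ "vs @ ws"]) auto
  then show ?thesis unfolding word_length_def by (rule Least_le)
qed

text \<open>The exchange of limits in abstract form: \<open>h\<close> is the entropy rate,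
  \<open>b e\<close> the rate from operator norms, \<open>E\<close> its limit in n. Each
  \<open>E e\<close> is a lower bound for the limit inferior of \<open>h\<close>, while
  \<open>low\<close> with n fixed gives h n - err n <= sup E. So \<open>h\<close> tends to sup E,
  and \<open>low\<close> for one large n then pushes \<open>E e\<close> up to the supremum as e
  tends to 0.\<close>

lemma sandwich_double_limit:
  fixes h err :: "nat \<Rightarrow> real" and E :: "real \<Rightarrow> real" and b :: "real \<Rightarrow> nat \<Rightarrow> real"
  assumes b: "\<And>e. 0 < e \<Longrightarrow> b e \<longlonglongrightarrow> E e" and bh: "\<And>e n. 0 < e \<Longrightarrow> b e n \<le> h n"
    and B: "\<And>n. h n \<le> B" and err: "err \<longlonglongrightarrow> 0"
    and low: "\<And>n d. n \<ge> 1 \<Longrightarrow> d > 0 \<Longrightarrow> \<forall>\<^sub>F e in at_right 0. h n - err n - d \<le> E e"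
  obtains c where "h \<longlonglongrightarrow> c" "(E \<longlongrightarrow> c) (at_right 0)"
proof -
  define c where "c = Sup (E ` {0<..})"
  have EB: "E e \<le> B" if "e > 0" for e
    using b[OF that] by (rule tendsto_upperbound) (simp_all add: order_trans[OF bh[OF that] B])
  have bdd: "bdd_above (E ` {0<..})" using EB by (intro bdd_aboveI[of _ B]) auto
  have Ec: "E e \<le> c" if "e > 0" for e unfolding c_def using that bdd by (intro cSup_upper) auto
  have hc: "h n - err n \<le> c" if "n \<ge> 1" for n
  proof (rule field_le_epsilon)
    fix d :: real assume d: "d > 0"
    have "\<forall>\<^sub>F e in at_right 0. h n - err n - d \<le> E e \<and> e \<in> {0<..<(1::real)}"
      using low[OF that d] eventually_at_right_real[of 0 "1::real"] by (intro eventually_conj) auto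
    then obtain e where "h n - err n - d \<le> E e" "e > 0"
      using eventually_happens[of _ "at_right (0::real)"] by fastforce
    then show "h n - err n \<le> c + d" using Ec[of e] by linarith
  qed
  have hlim: "h \<longlonglongrightarrow> c"
  proof (rule LIMSEQ_I)
    fix r :: real assume r: "r > 0"
    have "c - r / 2 < Sup (E ` {0<..})" using r by (simp add: c_def)
    then obtain e where e: "e > 0" "c - r / 2 < E e"
      using less_cSup_iff[of "E ` {0<..}"] bdd by auto
    have "\<forall>\<^sub>F n in sequentially. c - r / 2 < b e n" using order_tendstoD(1)[OF b[OF e(1)] e(2)] .
    moreover have "\<forall>\<^sub>F n in sequentially. err n < r" using order_tendstoD(2)[OF err r] .
    ultimately have "\<forall>\<^sub>F n in sequentially. norm (h n - c) < r" using eventually_ge_at_top[of 1]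
    proof eventually_elim
      case (elim n)
      have "c - r / 2 < h n" using elim bh[OF e(1), of n] by linarith
      moreover have "h n < c + r" using hc[of n] elim by linarith
      ultimately show ?case using r by (simp add: abs_less_iff)
    qed
    then show "\<exists>no. \<forall>n\<ge>no. norm (h n - c) < r" by (simp add: eventually_sequentially)
  qed
  have "(E \<longlongrightarrow> c) (at_right 0)"
  proof (rule order_tendstoI)
    fix a assume "c < a"
    have "\<forall>\<^sub>F e in at_right 0. e \<in> {0<..<(1::real)}" by (rule eventually_at_right_real) simp
    then show "\<forall>\<^sub>F e in at_right 0. E e < a"
      by eventually_elim (use Ec \<open>c < a\<close> in \<open>auto intro: le_less_trans\<close>)
  next
    fix a assume a: "a < c"
    define d where "d = (c - a) / 2"
    have d: "d > 0" using a by (simp add: d_def)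
    have "(\<lambda>n. h n - err n) \<longlonglongrightarrow> c - 0" by (intro tendsto_diff hlim err)
    then have "\<forall>\<^sub>F n in sequentially. c - d < h n - err n" using d by (intro order_tendstoD) auto
    then have "\<forall>\<^sub>F n in sequentially. c - d < h n - err n \<and> n \<ge> 1"
      using eventually_ge_at_top by (intro eventually_conj)
    then obtain n where n: "n \<ge> 1" "c - d < h n - err n" by (auto simp: eventually_sequentially)
    show "\<forall>\<^sub>F e in at_right 0. a < E e"
      using low[OF n(1) d] by eventually_elim (use n(2) in \<open>simp add: d_def field_simps\<close>)
  qed
  then show ?thesis using hlim that by blast
qed

context coset_random_walk begin

lemma shannon_seq_eq:
  assumes "integrable (measure_pmf \<mu>) (\<lambda>g. - ln (pmf \<mu> g))"
  shows "shannon_seq G H \<mu> n = ereal (measure_pmf.expectation (\<nu> n) (\<lambda>x. - ln (pmf (\<nu> n) x)) / real n)"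
  unfolding shannon_seq_def shannon_entropy_eq_expectation[OF \<nu>_entropy(1)[OF assms]] by simp

lemma entropy_renyi_radius_limits:
  assumes h: "integrable (measure_pmf \<mu>) (\<lambda>g. - ln (pmf \<mu> g))"
    and l: "\<And>g h. g \<in> carrier G \<Longrightarrow> h \<in> carrier G \<Longrightarrow> l (g \<otimes> h) \<le> l g + l h"
    and rd: "pair_rapid_decay G H l C s" and \<beta>: "\<beta> \<ge> 2 * s"
    and mom: "(\<lambda>g. pmf \<mu> g * (1 + real (l g)) powr \<beta>) summable_on carrier G"
  obtains c where "(\<lambda>n. measure_pmf.expectation (\<nu> n) (\<lambda>x. - ln (pmf (\<nu> n) x)) / real n) \<longlonglongrightarrow> c"
    "(renyi_radius \<longlongrightarrow> c) (at_right 0)"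
proof -
  have s: "s > 0" using rd by (simp add: pair_rapid_decay_def)
  have ge1: "1 + real (l g) \<ge> 1" for g by simp
  have int: "integrable (measure_pmf \<mu>) (\<lambda>g. (1 + real (l g)) powr \<beta>)"
  proof -
    have "(\<lambda>g. pmf \<mu> g * (1 + real (l g)) powr \<beta>) summable_on UNIV"
      using mom support by (subst summable_on_cong_neutral[where T = "carrier G" and g = "\<lambda>g. pmf \<mu> g * (1 + real (l g)) powr \<beta>"])
        (auto simp: set_pmf_iff subset_iff)
    then have "Infinite_Sum.abs_summable_on (\<lambda>g. pmf \<mu> g * (1 + real (l g)) powr \<beta>) UNIV"
      by (subst summable_on_iff_abs_summable_on_real[symmetric])
    then have "integrable (count_space UNIV) (\<lambda>g. pmf \<mu> g *\<^sub>R (1 + real (l g)) powr \<beta>)"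
      unfolding abs_summable_equivalent by (simp add: Infinite_Set_Sum.abs_summable_on_def)
    then show ?thesis unfolding measure_pmf_eq_density by (subst integrable_density) auto
  qed
  have int_le: "integrable (measure_pmf \<mu>) (\<lambda>g. (1 + real (l g)) powr r)" if "r \<le> \<beta>" for r
    by (rule Bochner_Integration.integrable_bound[OF int]) (use that ge1 in \<open>auto intro!: powr_mono\<close>)
  have w2s: "integrable (measure_pmf (m n)) (\<lambda>g. (1 + real (l g)) powr (2 * s))" for n
  proof (rule moment_power)
    fix g h assume gh: "g \<in> carrier G" "h \<in> carrier G"
    have "1 + real (l (g \<otimes> h)) \<le> 1 + real (l g) + real (l h)" using l[OF gh] by simp
    also have "\<dots> \<le> (1 + real (l g)) * (1 + real (l h))" by (simp add: algebra_simps)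
    finally have "(1 + real (l (g \<otimes> h))) powr (2 * s) \<le> ((1 + real (l g)) * (1 + real (l h))) powr (2 * s)"
      using s by (intro powr_mono2) auto
    then show "(1 + real (l (g \<otimes> h))) powr (2 * s) \<le> (1 + real (l g)) powr (2 * s) * (1 + real (l h)) powr (2 * s)"
      by (simp add: powr_mult)
  qed (use int_le \<beta> in auto)
  \<comment> \<open>Subadditivity of the weight needs r <= 1, its integrability r <=
    \<beta>.\<close>
  define r where "r = min 1 (2 * s)"
  have r: "0 < r" "r \<le> 1" "r \<le> \<beta>" using s \<beta> by (auto simp: r_def)
  define K D where "K = measure_pmf.expectation \<mu> (\<lambda>g. (1 + real (l g)) powr r)" and "D = (1 + real (l \<one>)) powr r"
  have K: "K \<ge> 0" by (simp add: K_def)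
  have D: "D > 0" by (simp add: D_def add_pos_nonneg)
  have lm: "integrable (measure_pmf (m n)) (\<lambda>g. ln (1 + real (l g)))"
    "measure_pmf.expectation (m n) (\<lambda>g. ln (1 + real (l g))) \<le> ln (real n * K + D) / r" for n
    unfolding K_def D_def using log_moment[of l r n] l r(1,2) int_le[OF r(3)] by auto
  define ho where "ho n = measure_pmf.expectation (\<nu> n) (\<lambda>x. - ln (pmf (\<nu> n) x)) / real n" for n
  define err where "err n = (2 * s * (ln (real n * K + D) / r) + 2 * ln C) / real n" for n
  have "err \<longlonglongrightarrow> 0"
  proof (cases "K = 0")
    case True
    then show ?thesis unfolding err_def by simp real_asymp
  next
    case False
    then have "K > 0" using K by simp
    then show ?thesis unfolding err_def using D r(1) s by real_asymp
  qed
  moreover have "\<forall>\<^sub>F e in at_right 0. ho n - err n - d \<le> renyi_radius e" if n: "n \<ge> 1" and d: "d > 0" for n d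
  proof -
    \<comment> \<open>\<open>renyi_radius_ge\<close> divides its slack by n, hence the choice d
      n.\<close>
    have "d * real n > 0" using n d by simp
    from renyi_radius_ge[OF h rd s w2s lm(1) n this] show ?thesis
    proof eventually_elim
      case (elim e)
      have "2 * s * measure_pmf.expectation (m n) (\<lambda>g. ln (1 + real (l g))) \<le> 2 * s * (ln (real n * K + D) / r)"
        using lm(2)[of n] s by (intro mult_left_mono) auto
      then have "(measure_pmf.expectation (\<nu> n) (\<lambda>x. - ln (pmf (\<nu> n) x)) - 2 * s * (ln (real n * K + D) / r) - 2 * ln C - d * real n) / real n
        \<le> (measure_pmf.expectation (\<nu> n) (\<lambda>x. - ln (pmf (\<nu> n) x)) - 2 * s * measure_pmf.expectation (m n) (\<lambda>g. ln (1 + real (l g))) - 2 * ln C - d * real n) / real n"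
        by (intro divide_right_mono) auto
      also note elim
      finally show ?case using n unfolding ho_def err_def by (simp add: diff_divide_distrib add_divide_distrib)
    qed
  qed
  moreover have "ho n \<le> measure_pmf.expectation \<mu> (\<lambda>g. - ln (pmf \<mu> g))" for n
  proof (cases "n = 0")
    \<comment> \<open>\<open>ho 0 = 0\<close> by the convention on division, so this case asks for
      nonnegativity of the entropy.\<close>
    case True
    have "- ln (pmf \<mu> g) \<ge> 0" for g
      using pmf_le_1[of \<mu> g] pmf_nonneg[of \<mu> g] by (cases "pmf \<mu> g = 0") auto
    then have "measure_pmf.expectation \<mu> (\<lambda>g. - ln (pmf \<mu> g)) \<ge> 0" by (rule Bochner_Integration.integral_nonneg)
    then show ?thesis using True by (simp add: ho_def)
  next
    case False
    then show ?thesis using \<nu>_entropy(2)[OF h, of n] unfolding ho_def by (simp add: field_simps)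
  qed
  moreover have "- ((1 + e) / e) * (ln (opn (1 + e) n) / real n) \<le> ho n" if "e > 0" for e n
    using order_trans[OF renyi_seq_ge[OF that] renyi_seq_le[OF h that]] unfolding ho_def .
  ultimately obtain c where "ho \<longlonglongrightarrow> c" "(renyi_radius \<longlongrightarrow> c) (at_right 0)"
    using sandwich_double_limit[of "\<lambda>e n. - ((1 + e) / e) * (ln (opn (1 + e) n) / real n)" renyi_radius ho
        "measure_pmf.expectation \<mu> (\<lambda>g. - ln (pmf \<mu> g))" err] renyi_radius_limit[OF h] by blast
  then show ?thesis using that unfolding ho_def[abs_def] by blast
qed

end

theorem theorem1p1:
  fixes G :: "('a, 'b) monoid_scheme" and H S :: "'a set" and \<mu> :: "'a pmf"
    and C\<^sub>h s\<^sub>1 \<beta> :: real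
  assumes "group G"
    and "symmetric_generating_set G S"
    and "subgroup H G"
    and "pair_rapid_decay G H (word_length G S) C\<^sub>h s\<^sub>1"
    and "set_pmf \<mu> \<subseteq> carrier G"
    and "shannon_entropy \<mu> < \<infinity>"
    and "\<beta> \<ge> 2 * s\<^sub>1"
    and "(\<lambda>g. pmf \<mu> g * (1 + real (word_length G S g)) powr \<beta>) summable_on carrier G"
  shows
    "lower_shannon G H \<mu> = upper_shannon G H \<mu> \<and>
     upper_shannon G H \<mu> = entropy_const G H \<mu> \<and>
     convergent (shannon_seq G H \<mu>) \<and> \<bar>asymp_shannon G H \<mu>\<bar> \<noteq> \<infinity> \<and>
     ((\<lambda>\<alpha>. lower_renyi G H \<mu> \<alpha>) \<longlongrightarrow> asymp_shannon G H \<mu>) (at_right 1) \<and>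
     ((\<lambda>\<alpha>. upper_renyi G H \<mu> \<alpha>) \<longlongrightarrow> asymp_shannon G H \<mu>) (at_right 1) \<and>
     (finite (set_pmf \<mu>) \<longrightarrow>
        (\<forall>\<alpha>\<in>{1<..2}.
           convergent (renyi_seq G H \<mu> \<alpha>) \<and>
           asymp_renyi G H \<mu> \<alpha> = \<alpha> / (1 - \<alpha>) * ln (quasi_regular_radius G H \<mu> \<alpha>)) \<and>
        ((\<lambda>\<alpha>. ereal (asymp_renyi G H \<mu> \<alpha>)) \<longlongrightarrow> asymp_shannon G H \<mu>) (at_right 1))"
proof -
  interpret coset_random_walk G H \<mu>
    using assms by (simp add: coset_random_walk_def coset_random_walk_axioms_def coset_space_def coset_space_axioms_def)
  have h: "integrable (measure_pmf \<mu>) (\<lambda>g. - ln (pmf \<mu> g))"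
    using assms(6) by (rule shannon_entropy_finite_integrable)
  note l = word_length_mult[OF assms(2)]
  obtain c where c: "(\<lambda>n. measure_pmf.expectation (\<nu> n) (\<lambda>x. - ln (pmf (\<nu> n) x)) / real n) \<longlonglongrightarrow> c"
      and Ec: "(renyi_radius \<longlongrightarrow> c) (at_right 0)"
    using entropy_renyi_radius_limits[OF h l assms(4,7,8)] by blast
  have sh: "shannon_seq G H \<mu> \<longlonglongrightarrow> ereal c"
    unfolding shannon_seq_eq[OF h, abs_def] using c by simp
  have lower: "lower_shannon G H \<mu> = ereal c" and upper: "upper_shannon G H \<mu> = ereal c"
    unfolding lower_shannon_def upper_shannon_def using sh by (auto intro!: lim_imp_Liminf lim_imp_Limsup)
  have asymp: "asymp_shannon G H \<mu> = ereal c" unfolding asymp_shannon_def using sh by (rule limI)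
  have near: "\<forall>\<^sub>F e in at_right 0. e \<in> {0<..<(1::real)}" by (rule eventually_at_right_real) simp
  have ereal_Ec: "((\<lambda>e. ereal (renyi_radius e)) \<longlongrightarrow> ereal c) (at_right 0)" using Ec by simp
  have const: "entropy_const G H \<mu> = ereal c"
  proof -
    \<comment> \<open>The parametrisations 1 + e and p/(p - 1) of alpha agree for e = 1/(p - 1), and
      then (1 + e)/e = p.\<close>
    have f: "filterlim (\<lambda>p::real. 1 / (p - 1)) (at_right 0) at_top" by real_asymp
    have "((\<lambda>p. ereal (renyi_radius (1 / (p - 1)))) \<longlongrightarrow> ereal c) at_top"
      using filterlim_compose[OF ereal_Ec f] .
    moreover have "\<forall>\<^sub>F p in at_top. ereal (renyi_radius (1 / (p - 1))) = ereal (- p * ln (\<rho> (p / (p - 1))))"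
      using eventually_gt_at_top[of 1]
    proof eventually_elim
      case (elim p)
      then have "1 + 1 / (p - 1) = p / (p - 1)" "p / (p - 1) / (1 / (p - 1)) = p" by (simp_all add: field_simps)
      then show ?case unfolding renyi_radius_def by simp
    qed
    ultimately have "((\<lambda>p. ereal (- p * ln (\<rho> (p / (p - 1))))) \<longlongrightarrow> ereal c) at_top"
      using tendsto_cong by force
    then show ?thesis unfolding entropy_const_def by (intro tendsto_Lim) auto
  qed
  \<comment> \<open>\<open>low\<close>, \<open>mid\<close> and \<open>up\<close> squeeze both Renyi
    rates between \<open>renyi_radius e\<close> and \<open>c\<close>; the former tends to
    \<open>c\<close> as e tends to 0.\<close>
  have low: "ereal (renyi_radius e) \<le> lower_renyi G H \<mu> (1 + e)" if e: "e > 0" for e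
  proof -
    have "ereal (renyi_radius e) = liminf (\<lambda>n. ereal (- ((1 + e) / e) * (ln (opn (1 + e) n) / real n)))"
      using renyi_radius_limit[OF h e] by (intro lim_imp_Liminf[symmetric] tendsto_ereal) auto
    also have "\<dots> \<le> lower_renyi G H \<mu> (1 + e)" unfolding lower_renyi_def
      using renyi_seq_ge[OF e] by (intro Liminf_mono always_eventually) auto
    finally show ?thesis .
  qed
  have mid: "lower_renyi G H \<mu> (1 + e) \<le> upper_renyi G H \<mu> (1 + e)" for e
    unfolding lower_renyi_def upper_renyi_def by (rule Liminf_le_Limsup) simp
  have up: "upper_renyi G H \<mu> (1 + e) \<le> ereal c" if e: "e > 0" for e
  proof -
    have "upper_renyi G H \<mu> (1 + e) \<le> upper_shannon G H \<mu>"
      unfolding upper_renyi_def upper_shannon_def shannon_seq_eq[OF h, abs_def]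
      using renyi_seq_le[OF h e] by (intro Limsup_mono always_eventually) auto
    then show ?thesis by (simp add: upper)
  qed
  have lr: "((\<lambda>\<alpha>. lower_renyi G H \<mu> \<alpha>) \<longlongrightarrow> ereal c) (at_right 1)"
    unfolding filterlim_at_right_to_0[of _ _ 1]
  proof (rule tendsto_sandwich[OF _ _ ereal_Ec tendsto_const])
    show "\<forall>\<^sub>F e in at_right 0. ereal (renyi_radius e) \<le> lower_renyi G H \<mu> (e + 1)"
      using near by eventually_elim (use low in \<open>simp add: add.commute\<close>)
    show "\<forall>\<^sub>F e in at_right 0. lower_renyi G H \<mu> (e + 1) \<le> ereal c"
      using near by eventually_elim (use order_trans[OF mid up] in \<open>simp add: add.commute\<close>)
  qed
  have ur: "((\<lambda>\<alpha>. upper_renyi G H \<mu> \<alpha>) \<longlongrightarrow> ereal c) (at_right 1)"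
    unfolding filterlim_at_right_to_0[of _ _ 1]
  proof (rule tendsto_sandwich[OF _ _ ereal_Ec tendsto_const])
    show "\<forall>\<^sub>F e in at_right 0. ereal (renyi_radius e) \<le> upper_renyi G H \<mu> (e + 1)"
      using near by eventually_elim (use order_trans[OF low mid] in \<open>simp add: add.commute\<close>)
    show "\<forall>\<^sub>F e in at_right 0. upper_renyi G H \<mu> (e + 1) \<le> ereal c"
      using near by eventually_elim (use up in \<open>simp add: add.commute\<close>)
  qed
  have fin: "(\<forall>\<alpha>\<in>{1<..2}. convergent (renyi_seq G H \<mu> \<alpha>) \<and>
           asymp_renyi G H \<mu> \<alpha> = \<alpha> / (1 - \<alpha>) * ln (\<rho> \<alpha>)) \<and>
        ((\<lambda>\<alpha>. ereal (asymp_renyi G H \<mu> \<alpha>)) \<longlongrightarrow> ereal c) (at_right 1)" if fs: "finite (set_pmf \<mu>)"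
  proof -
    have lim: "renyi_seq G H \<mu> (1 + e) \<longlonglongrightarrow> renyi_radius e" if "0 < e" "e \<le> 1" for e
      using renyi_seq_finite_support[OF h assms(4) l fs that] .
    have ar: "asymp_renyi G H \<mu> (1 + e) = renyi_radius e" if "0 < e" "e \<le> 1" for e
      unfolding asymp_renyi_def using lim[OF that] by (rule limI)
    have "convergent (renyi_seq G H \<mu> \<alpha>) \<and> asymp_renyi G H \<mu> \<alpha> = \<alpha> / (1 - \<alpha>) * ln (\<rho> \<alpha>)"
      if "\<alpha> \<in> {1<..2}" for \<alpha>
    proof -
      have e: "0 < \<alpha> - 1" "\<alpha> - 1 \<le> 1" using that by auto
      have "- (\<alpha> / (\<alpha> - 1)) = \<alpha> / (1 - \<alpha>)" using e by (simp add: field_simps)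
      then show ?thesis using lim[OF e] ar[OF e] by (auto simp: convergent_def renyi_radius_def)
    qed
    moreover have "((\<lambda>\<alpha>. ereal (asymp_renyi G H \<mu> \<alpha>)) \<longlongrightarrow> ereal c) (at_right 1)"
      unfolding filterlim_at_right_to_0[of _ _ 1]
    proof (rule Lim_transform_eventually[OF ereal_Ec])
      show "\<forall>\<^sub>F e in at_right 0. ereal (renyi_radius e) = ereal (asymp_renyi G H \<mu> (e + 1))"
        using near by eventually_elim (use ar in \<open>simp add: add.commute\<close>)
    qed
    ultimately show ?thesis by blast
  qed
  show ?thesis
    using sh lr ur fin unfolding lower upper const asymp by (auto simp: convergent_def)
qed

end
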